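(* Let $f:S^{n-1}\to Cl_n$ be a real analytic function on the unit sphere $S^{n-1}\subset\mathbb{R}^n$. Then there is a unique left Clifford holomorphic function $F$ defined on an open neighbourhood $U(f)$ of $S^{n-1}$ in $\mathbb{R}^n$ such that $F|_{S^{n-1}}=f$.
   Context: $Cl_n$ is the real Clifford algebra generated by an orthonormal basis $e_1,\ldots,e_n$ of $\mathbb{R}^n$ with $e_ie_j+e_je_i=-2\delta_{ij}$. A function $F$ is left Clifford holomorphic if $\sum_j e_j\partial F/\partial x_j=0$. *)

theory Defs
  imports "HOL-Analysis.Analysis"
begin

text \<open>The real Clifford algebra Cl_n, with n = CARD('n) and the generators e_1..e_n
  indexed by a finite linearly ordered type 'n.  An element is represented by its
  coordinates with respect to the basis blades e_A (A a subset of the index set),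
  e_A = e_a1 e_a2 ... e_ak with a1 < a2 < ... < ak.\<close>

type_synonym 'n clifford = "real ^ ('n set)"

text \<open>Sign in e_A e_B = sign A B e_(A symmetric-difference B), using e_i e_i = -1.\<close>
definition blade_sign :: "'n::{finite,linorder} set \<Rightarrow> 'n set \<Rightarrow> real" where
  "blade_sign A B = (-1) ^ card {(a, b). a \<in> A \<and> b \<in> B \<and> b < a} * (-1) ^ card (A \<inter> B)"

definition clmul :: "'n::{finite,linorder} clifford \<Rightarrow> 'n clifford \<Rightarrow> 'n clifford" where
  "clmul x y = (\<chi> C. \<Sum>A\<in>UNIV. \<Sum>B\<in>UNIV.
       if (A - B) \<union> (B - A) = C then blade_sign A B * (x $ A) * (y $ B) else 0)"

definition cl_gen :: "'n::{finite,linorder} \<Rightarrow> 'n clifford" where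
  "cl_gen j = (\<chi> A. if A = {j} then 1 else 0)"

definition partial :: "(real ^ 'n \<Rightarrow> 'n clifford) \<Rightarrow> 'n \<Rightarrow> real ^ 'n \<Rightarrow> 'n clifford" where
  "partial F j x = frechet_derivative F (at x) (axis j (1::real))"

definition left_clifford_holomorphic_on ::
    "((real, 'n::{finite,linorder}) vec \<Rightarrow> 'n clifford) \<Rightarrow> (real, 'n) vec set \<Rightarrow> bool" where
  "left_clifford_holomorphic_on F U \<longleftrightarrow>
     open U \<and> (\<forall>x\<in>U. F differentiable (at x)) \<and>
     (\<forall>j. continuous_on U (partial F j)) \<and>
     (\<forall>x\<in>U. (\<Sum>j\<in>UNIV. clmul (cl_gen j) (partial F j x)) = 0)"

definition real_analytic_at :: "(real ^ 'n \<Rightarrow> 'a::real_normed_vector) \<Rightarrow> real ^ 'n \<Rightarrow> bool" where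
  "real_analytic_at g p \<longleftrightarrow>
     (\<exists>r>0. \<exists>c :: ('n \<Rightarrow> nat) \<Rightarrow> 'a. \<forall>x\<in>ball p r.
        (\<lambda>\<alpha>. norm ((\<Prod>i\<in>UNIV. (x $ i - p $ i) ^ \<alpha> i) *\<^sub>R c \<alpha>)) summable_on UNIV \<and>
        ((\<lambda>\<alpha>. (\<Prod>i\<in>UNIV. (x $ i - p $ i) ^ \<alpha> i) *\<^sub>R c \<alpha>) has_sum g x) UNIV)"

text \<open>Real analytic function on the unit sphere S^(n-1) (an embedded real analytic
  submanifold of R^n): near each point of the sphere it is the restriction of a
  real analytic function on an open set of R^n.\<close>
definition real_analytic_on_sphere :: "(real ^ 'n \<Rightarrow> 'a::real_normed_vector) \<Rightarrow> bool" where
  "real_analytic_on_sphere f \<longleftrightarrow>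
     (\<forall>p\<in>sphere 0 1. \<exists>g. real_analytic_at g p \<and>
        (\<exists>r>0. \<forall>x\<in>sphere 0 1 \<inter> ball p r. g x = f x))"

end

theory Submission
  imports Defs
begin

text \<open>
  Existence.  Write \<open>D\<close> for the Dirac operator and \<open>x\<close> for Clifford multiplication by the
  position vector.  If \<open>g\<close> is a real analytic extension of \<open>f\<close> near a point of the sphere, then
  \<open>F = \<Sum>k. (ln |x|)\<^sup>k / k! (x D)\<^sup>k g\<close> restricts to \<open>g\<close> on the sphere and \<open>D F\<close> telescopes to
  \<open>0\<close>.  It converges near the sphere because \<open>x D\<close> is a first order operator with linear
  coefficients, so in the scale of weighted \<open>l\<^sup>1\<close> norms of power series it loses a factor
  \<open>1 / (s - t)\<close> when the radius shrinks from \<open>s\<close> to \<open>t\<close>; splitting the loss into \<open>k\<close> equal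
  steps bounds \<open>(x D)\<^sup>k g\<close> by \<open>A\<^sup>k k! M\<close>.

  Uniqueness.  A Clifford holomorphic function has a mean value property for radial weights.
  Hence its partial derivatives are again Clifford holomorphic and satisfy Cauchy estimates.
  If it vanishes on the sphere, so do its partial derivatives, hence all iterated ones, and Taylor
  expansion shows that it vanishes on a ball around each point of the sphere.  The radius of that
  ball is a fixed multiple of the radius on which the function is defined, which also makes
  the local solutions agree where they overlap.
\<close>

section \<open>Multiplication by the generators\<close>

text \<open>The regularity proof therefore works with averages against a radial weight that vanishes
  outside the unit ball: no boundary terms arise, and one integration by parts moves the derivative
  onto the weight, so that second derivatives of F need not exist beforehand. One algebraic
  identity, \<open>clmul_gen_symmetric_sum\<close>, carries the mean value property, the vanishing
  of the normal derivative and the telescoping.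

  Both halves must iterate an operator that costs 1 / (loss of radius). Taking k equal steps costs a
  multiple of k^k up to a geometric factor, and k^k <= e^k k!
  (\<open>power_self_le_exp_fact\<close>) makes this absorbable by the 1 / k! of the Taylor
  remainder, respectively of the logarithmic series.

  The series for F is formally exp (ln |x| (x D)) g with ln |x| treated as a parameter while x D
  acts; it solves the Cauchy problem with data on |x| = 1. A priori it depends on the chosen
  extension g and on the point of the sphere; local uniqueness removes this dependence.\<close>

definition flip :: "'a \<Rightarrow> 'a set \<Rightarrow> 'a set" where
  "flip j C = ({j} - C) \<union> (C - {j})"

lemma flip_flip [simp]: "flip j (flip j C) = C"
  by (auto simp: flip_def)

lemma flip_commute: "flip i (flip j C) = flip j (flip i C)"
  by (auto simp: flip_def)

lemma bij_flip: "bij (flip j)"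
  by (rule o_bij[of "flip j"]) (auto simp: fun_eq_iff)

text \<open>In e_j e_B the generator e_j passes the elements of \<open>B\<close> below
  \<open>j\<close>, and if \<open>j\<close> is in \<open>B\<close> one more sign comes from e_j e_j
  = -1. The two counts merge into the elements of \<open>B\<close> up to and including
  \<open>j\<close>.\<close>

definition gen_sign :: "'n::{finite,linorder} \<Rightarrow> 'n set \<Rightarrow> real" where
  "gen_sign j B = (-1) ^ card (B \<inter> {..j})"

text \<open>Flipping \<open>j\<close> changes the counted set by one element exactly when
  \<open>j \<le> i\<close>. This asymmetry is the source of anticommutation.\<close>

lemma gen_sign_flip:
  "gen_sign i (flip j C) = (if j \<le> i then - gen_sign i C else gen_sign i C)"
proof (cases "j \<le> i")
  case True
  show ?thesis
  proof (cases "j \<in> C")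
    case jC: True
    have "C \<inter> {..i} = insert j (flip j C \<inter> {..i})" "j \<notin> flip j C \<inter> {..i}"
      using True jC by (auto simp: flip_def)
    then have "card (C \<inter> {..i}) = Suc (card (flip j C \<inter> {..i}))"
      by (metis card_insert_disjoint finite)
    then show ?thesis using True by (simp add: gen_sign_def)
  next
    case False
    have "flip j C \<inter> {..i} = insert j (C \<inter> {..i})" "j \<notin> C \<inter> {..i}"
      using True False by (auto simp: flip_def)
    then have "card (flip j C \<inter> {..i}) = Suc (card (C \<inter> {..i}))"
      by (metis card_insert_disjoint finite)
    then show ?thesis using True by (simp add: gen_sign_def)
  qed
next
  case False
  then have "flip j C \<inter> {..i} = C \<inter> {..i}" by (auto simp: flip_def)
  then show ?thesis using False by (simp add: gen_sign_def)
qed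

lemma blade_sign_singleton: "blade_sign {j} B = gen_sign j B"
proof -
  have "{(a, b). a \<in> {j} \<and> b \<in> B \<and> b < a} = Pair j ` (B \<inter> {..<j})" by auto
  then have 1: "card {(a, b). a \<in> {j} \<and> b \<in> B \<and> b < a} = card (B \<inter> {..<j})"
    by (simp add: card_image inj_on_def)
  have "B \<inter> {..j} = (B \<inter> {..<j}) \<union> ({j} \<inter> B)" by auto
  moreover have "card ((B \<inter> {..<j}) \<union> ({j} \<inter> B)) = card (B \<inter> {..<j}) + card ({j} \<inter> B)"
    by (rule card_Un_disjoint) auto
  ultimately show ?thesis by (simp only: blade_sign_def gen_sign_def 1 power_add)
qed

text \<open>Only the blade \<open>B = flip j C\<close> contributes to coordinate \<open>C\<close>,
  so the double sum collapses to a signed permutation of the coordinates. All later Clifford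
  computations go through this form.\<close>

lemma clmul_gen_nth:
  "clmul (cl_gen j) y $ C = - gen_sign j C * y $ flip j C"
proof -
  have "clmul (cl_gen j) y $ C =
      (\<Sum>A\<in>UNIV. if A = {j} then \<Sum>B\<in>UNIV. if flip j B = C then gen_sign j B * y $ B else 0 else 0)"
    unfolding clmul_def cl_gen_def
  proof (simp only: vec_lambda_beta, rule sum.cong[OF refl])
    fix A
    show "(\<Sum>B\<in>UNIV. if A - B \<union> (B - A) = C
          then blade_sign A B * (if A = {j} then 1 else 0) * y $ B else 0) =
        (if A = {j} then \<Sum>B\<in>UNIV. if flip j B = C then gen_sign j B * y $ B else 0 else 0)"
      by (cases "A = {j}") (auto simp: blade_sign_singleton flip_def cong: if_cong)
  qed
  also have "\<dots> = (\<Sum>B\<in>UNIV. if B = flip j C then gen_sign j B * y $ B else 0)"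
  proof -
    have "flip j B = C \<longleftrightarrow> B = flip j C" for B by auto
    then show ?thesis by simp
  qed
  also have "\<dots> = - gen_sign j C * y $ flip j C"
    by (simp add: gen_sign_flip)
  finally show ?thesis .
qed

lemma gen_sign_sq: "gen_sign j C * gen_sign j C = 1"
  by (simp add: gen_sign_def flip: power_add mult_2)

lemma norm_clmul_gen: "norm (clmul (cl_gen j) y) = norm y"
proof -
  have "(\<Sum>C\<in>UNIV. (clmul (cl_gen j) y $ C)\<^sup>2) = (\<Sum>C\<in>UNIV. (y $ flip j C)\<^sup>2)"
    by (intro sum.cong refl) (simp add: clmul_gen_nth power_mult_distrib power2_eq_square gen_sign_sq)
  also have "\<dots> = (\<Sum>C\<in>UNIV. (y $ C)\<^sup>2)"
    by (rule sum.reindex_bij_betw[OF bij_flip])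
  finally show ?thesis by (simp add: norm_vec_def L2_set_def)
qed

lemma bounded_linear_clmul_gen: "bounded_linear (clmul (cl_gen j))"
proof (rule bounded_linear_intro[where K = 1])
  show "clmul (cl_gen j) (x + y) = clmul (cl_gen j) x + clmul (cl_gen j) y" for x y
    by (simp add: vec_eq_iff clmul_gen_nth algebra_simps)
  show "clmul (cl_gen j) (r *\<^sub>R x) = r *\<^sub>R clmul (cl_gen j) x" for r x
    by (simp add: vec_eq_iff clmul_gen_nth)
qed (simp add: norm_clmul_gen)

lemmas clmul_gen_zero = linear_0[OF bounded_linear.linear[OF bounded_linear_clmul_gen]]
  and clmul_gen_add = linear_add[OF bounded_linear.linear[OF bounded_linear_clmul_gen]]
  and clmul_gen_diff = linear_diff[OF bounded_linear.linear[OF bounded_linear_clmul_gen]]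
  and clmul_gen_scaleR = linear_scale[OF bounded_linear.linear[OF bounded_linear_clmul_gen]]
  and clmul_gen_sum = linear_sum[OF bounded_linear.linear[OF bounded_linear_clmul_gen]]

text \<open>Both orders reach the same coordinate, so only signs matter. For distinct indices
  exactly one of \<open>i \<le> j\<close> and \<open>j \<le> i\<close> holds, hence exactly one of
  the two products picks up the extra minus sign of \<open>gen_sign_flip\<close>.\<close>

lemma clmul_gen_anticommute:
  "clmul (cl_gen i) (clmul (cl_gen j) y) + clmul (cl_gen j) (clmul (cl_gen i) y)
     = (if i = j then - 2 *\<^sub>R y else 0)"
proof (cases "i = j")
  case True
  have "gen_sign j C * (gen_sign j C * y $ C) = y $ C" for C
    by (simp add: gen_sign_sq flip: mult.assoc)
  then show ?thesis using True
    by (simp add: vec_eq_iff clmul_gen_nth gen_sign_flip)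
next
  case False
  then have "(i \<le> j) = (\<not> j \<le> i)" by auto
  then show ?thesis using False
    by (simp add: vec_eq_iff clmul_gen_nth gen_sign_flip flip_commute[of i j] mult_ac)
qed

text \<open>The algebra behind D^2 = - Laplace, freed from derivatives. With \<open>T i j\<close> of
  the form x_i x_j y it says that multiplying twice by the vector x gives - |x|^2.\<close>

lemma clmul_gen_symmetric_sum:
  fixes T :: "'n::{finite,linorder} \<Rightarrow> 'n \<Rightarrow> 'n clifford"
  assumes "\<And>i j. T i j = T j i"
  shows "(\<Sum>i\<in>UNIV. \<Sum>j\<in>UNIV. clmul (cl_gen i) (clmul (cl_gen j) (T i j))) = - (\<Sum>i\<in>UNIV. T i i)"
    (is "?S = _")
proof -
  have "?S = (\<Sum>i\<in>UNIV. \<Sum>j\<in>UNIV. clmul (cl_gen j) (clmul (cl_gen i) (T i j)))"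
    by (subst sum.swap) (simp add: assms)
  then have "?S + ?S = (\<Sum>i\<in>UNIV. \<Sum>j\<in>UNIV. clmul (cl_gen i) (clmul (cl_gen j) (T i j))
      + clmul (cl_gen j) (clmul (cl_gen i) (T i j)))"
    by (simp add: sum.distrib)
  also have "\<dots> = (\<Sum>i\<in>UNIV. \<Sum>j\<in>UNIV. if i = j then - 2 *\<^sub>R T i j else 0)"
    by (simp only: clmul_gen_anticommute)
  also have "\<dots> = - 2 *\<^sub>R (\<Sum>i\<in>UNIV. T i i)"
    by (simp add: scaleR_sum_right sum_negf)
  finally have "2 *\<^sub>R ?S = 2 *\<^sub>R (- (\<Sum>i\<in>UNIV. T i i))"
    by (simp add: scaleR_2)
  then show ?thesis by (simp only: scaleR_cancel_left) simp
qed

section \<open>Integration by parts on the cube\<close>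

lemma has_derivative_affine_compose:
  assumes "(F has_derivative F') (at (x + t *\<^sub>R z))"
  shows "((\<lambda>z. F (x + t *\<^sub>R z)) has_derivative (\<lambda>h. F' (t *\<^sub>R h))) (at z)"
  by (rule has_derivative_compose[where f = "\<lambda>z. x + t *\<^sub>R z" and g = F])
    (use assms in \<open>auto intro!: derivative_eq_intros\<close>)

lemma has_vector_derivative_line_compose:
  assumes "(F has_derivative F') (at (x + t *\<^sub>R v))"
  shows "((\<lambda>t. F (x + t *\<^sub>R v)) has_vector_derivative F' v) (at t within S)"
proof -
  have "((\<lambda>t. F (x + t *\<^sub>R v)) has_derivative (\<lambda>u. F' (u *\<^sub>R v))) (at t within S)"
    by (rule has_derivative_compose[where f = "\<lambda>t. x + t *\<^sub>R v" and g = F])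
      (use assms in \<open>auto intro!: derivative_eq_intros\<close>)
  then show ?thesis
    by (simp add: has_vector_derivative_def linear_scale[OF has_derivative_linear[OF assms]])
qed

lemma vec_eq_sum_axis: "(h :: real ^ 'n) = (\<Sum>j\<in>UNIV. h $ j *\<^sub>R axis j 1)"
  using basis_expansion[of h] by (simp add: scalar_mult_eq_scaleR)

lemma sum_axis_scaleR: "(\<Sum>k\<in>UNIV. (axis j 1 :: real ^ 'n) $ k *\<^sub>R f k) = (f j :: 'b::real_vector)"
  by (simp add: axis_def if_distrib[of "\<lambda>u. u *\<^sub>R _"] cong: if_cong)

lemma linear_eq_sum_axis:
  fixes h :: "real ^ 'n"
  assumes "linear f"
  shows "f h = (\<Sum>j\<in>UNIV. h $ j *\<^sub>R f (axis j 1))"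
  by (subst vec_eq_sum_axis) (simp add: linear_sum[OF assms] linear_scale[OF assms])

lemma partial_eq:
  assumes "(F has_derivative F') (at x)"
  shows "partial F j x = F' (axis j 1)"
  unfolding partial_def using frechet_derivative_at[OF assms] by simp

lemma differentiable_imp_has_derivative_partial:
  assumes "F differentiable (at x)"
  shows "(F has_derivative (\<lambda>h. \<Sum>j\<in>UNIV. h $ j *\<^sub>R partial F j x)) (at x)"
proof -
  have 1: "(F has_derivative frechet_derivative F (at x)) (at x)"
    using assms by (simp add: frechet_derivative_works)
  then have "frechet_derivative F (at x) = (\<lambda>h. \<Sum>j\<in>UNIV. h $ j *\<^sub>R partial F j x)"
    unfolding partial_def by (intro ext linear_eq_sum_axis has_derivative_linear)
  with 1 show ?thesis by simp
qed

lemma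
  assumes "left_clifford_holomorphic_on F U"
  shows holo_open: "open U"
    and holo_has_derivative:
      "x \<in> U \<Longrightarrow> (F has_derivative (\<lambda>h. \<Sum>j\<in>UNIV. h $ j *\<^sub>R partial F j x)) (at x)"
    and holo_continuous_partial: "continuous_on U (partial F j)"
    and holo_Dirac: "x \<in> U \<Longrightarrow> (\<Sum>j\<in>UNIV. clmul (cl_gen j) (partial F j x)) = 0"
    and holo_continuous: "continuous_on U F"
  using assms unfolding left_clifford_holomorphic_on_def
  by (auto intro: differentiable_imp_has_derivative_partial
      intro!: continuous_at_imp_continuous_on differentiable_imp_continuous_within)

text \<open>Cubes serve twice: as integration domains whose boundary stays away from the support of
  the weights, and as domains of power series, since there the monomials obey
  \<open>abs_mpow_le\<close>.\<close>

abbreviation cube :: "real \<Rightarrow> (real ^ 'n) set" where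
  "cube a \<equiv> cbox (\<chi> i. - a) (\<chi> i. a)"

lemma mem_cube: "z \<in> cube a \<longleftrightarrow> (\<forall>i. \<bar>z $ i\<bar> \<le> a)"
  by (simp add: mem_box_cart abs_le_iff minus_le_iff[of "z $ _"] conj_commute)

lemma norm_le_of_mem_cube:
  fixes z :: "real ^ 'n"
  assumes "z \<in> cube a"
  shows "norm z \<le> a * real CARD('n)"
proof -
  have "norm z \<le> (\<Sum>i\<in>UNIV. \<bar>z $ i\<bar>)" by (rule norm_le_l1_cart)
  also have "\<dots> \<le> (\<Sum>i\<in>(UNIV::'n set). a)" using assms by (intro sum_mono) (auto simp: mem_cube)
  finally show ?thesis by (simp add: mult.commute)
qed

lemma cube_mono: "a \<le> b \<Longrightarrow> cube a \<subseteq> cube b"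
  unfolding subset_iff mem_cube by (meson order_trans)

text \<open>Translating \<open>H\<close> does not change its integral, so the derivative of the integral in the
  direction of the translation vanishes.\<close>
lemma integral_partial_eq_0:
  fixes H :: "real ^ 'n \<Rightarrow> 'b::banach"
  assumes zero: "\<And>z. norm z \<ge> 1 \<Longrightarrow> H z = 0"
    and deriv: "\<And>z. z \<in> cube 3 \<Longrightarrow> (H has_derivative H' z) (at z)"
    and cont: "continuous_on (cube 3) (\<lambda>z. H' z (axis j 1))"
  shows "integral (cube 2) (\<lambda>z. H' z (axis j 1)) = 0"
proof -
  let ?e = "axis j 1 :: real ^ 'n"
  let ?\<phi> = "\<lambda>t. integral (cube 2) (\<lambda>z. H (z + t *\<^sub>R ?e))"
  \<comment> \<open>The margins: \<open>H\<close> vanishes outside the unit ball, so the cube of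
    half-width 2 still contains the support after a shift by at most 1, while every point that is
    evaluated stays in the cube of half-width 3.\<close>
  have shift: "z + t *\<^sub>R ?e \<in> cube 3" if "z \<in> cube 2" "t \<in> {-1..1}" for z t
    unfolding mem_cube
  proof
    fix i
    have "\<bar>z $ i\<bar> \<le> 2" using that by (simp add: mem_cube)
    moreover have "\<bar>(t *\<^sub>R ?e) $ i\<bar> \<le> 1" using that by (auto simp: axis_def)
    ultimately show "\<bar>(z + t *\<^sub>R ?e) $ i\<bar> \<le> 3" by simp
  qed
  have contH: "continuous_on (cube 3) H"
    using deriv by (meson continuous_at_imp_continuous_on has_derivative_continuous)
  have "(?\<phi> has_vector_derivative integral (cube 2) (\<lambda>z. H' (z + 0 *\<^sub>R ?e) ?e))
      (at 0 within {-1..1})"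
  proof (rule leibniz_rule_vector_derivative[where fx = "\<lambda>t z. H' (z + t *\<^sub>R ?e) ?e"])
    fix t :: real and z :: "real ^ 'n" assume tz: "t \<in> {-1..1}" "z \<in> cube 2"
    show "((\<lambda>t. H (z + t *\<^sub>R ?e)) has_vector_derivative H' (z + t *\<^sub>R ?e) ?e)
        (at t within {-1..1})"
      by (intro has_vector_derivative_line_compose deriv shift tz)
  next
    fix t assume "t \<in> {-1..1::real}"
    then show "(\<lambda>z. H (z + t *\<^sub>R ?e)) integrable_on cube 2"
      by (intro integrable_continuous continuous_on_compose2[OF contH] continuous_intros)
        (auto intro: shift)
  next
    show "continuous_on ({- 1..1} \<times> cube 2) (\<lambda>(t, z). H' (z + t *\<^sub>R ?e) ?e)"
      unfolding case_prod_unfold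
      by (rule continuous_on_compose2[OF cont]) (auto intro!: continuous_intros shift)
  qed auto
  then have "(?\<phi> has_vector_derivative integral (cube 2) (\<lambda>z. H' z ?e)) (at 0)"
    by (simp add: at_within_interior[of 0 "{-1..1::real}"])
  moreover have const: "?\<phi> t = integral UNIV H" if t: "t \<in> {-1..1}" for t
  proof -
    let ?Q = "cbox ((\<chi> i. -2) + t *\<^sub>R ?e) ((\<chi> i. 2) + t *\<^sub>R ?e)"
    have "?\<phi> t = integral (cube 2) (H \<circ> (+) (t *\<^sub>R ?e))" by (simp add: o_def add.commute)
    also have "\<dots> = integral ?Q H" by (rule integral_shift_cbox_plus)
    also have "\<dots> = integral UNIV (\<lambda>x. if x \<in> ?Q then H x else 0)"
      by (rule integral_restrict_UNIV[symmetric])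
    also have "(\<lambda>x. if x \<in> ?Q then H x else 0) = H"
    proof
      fix x
      have "x \<in> ?Q" if "norm x < 1"
      proof -
        have "\<bar>x $ i\<bar> \<le> 1" for i using component_le_norm_cart[of x i] that by simp
        moreover have "\<bar>(t *\<^sub>R ?e) $ i\<bar> \<le> 1" for i using t by (auto simp: axis_def)
        ultimately show ?thesis by (auto simp: mem_box_cart abs_le_iff; smt (verit))
      qed
      then show "(if x \<in> ?Q then H x else 0) = H x" using zero[of x] by fastforce
    qed
    finally show ?thesis .
  qed
  have "(?\<phi> has_vector_derivative 0) (at 0)"
    by (rule has_vector_derivative_transform_within[of "\<lambda>_. integral UNIV H" _ _ _ 1])
      (auto simp: dist_real_def intro!: const[symmetric])
  ultimately show ?thesis using vector_derivative_unique_at by blast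
qed

text \<open>A radial weight vanishing outside the unit ball. The square makes the positive part C^1,
  which is what integration by parts needs; radial symmetry makes its gradient a multiple of
  \<open>z\<close>.\<close>

definition wt :: "real ^ 'n \<Rightarrow> real" where
  "wt z = (max 0 (1 - z \<bullet> z))\<^sup>2"

lemma DERIV_max_0_square: "((\<lambda>t. (max 0 t)\<^sup>2) has_real_derivative 2 * max 0 t) (at (t::real))"
proof -
  consider "t < 0" | "t > 0" | "t = 0" by linarith
  then show ?thesis
  proof cases
    case 1
    have "((\<lambda>t. (max 0 t)\<^sup>2) has_real_derivative 0) (at t)"
      by (rule has_field_derivative_transform_within_open[of "\<lambda>_. 0" _ _ "{..<0}"]) (use 1 in auto)
    then show ?thesis using 1 by simp
  next
    case 2
    have "((\<lambda>t. t\<^sup>2) has_real_derivative 2 * t) (at t)" by (auto intro!: derivative_eq_intros)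
    then have "((\<lambda>t. (max 0 t)\<^sup>2) has_real_derivative 2 * t) (at t)"
      by (rule has_field_derivative_transform_within_open[of _ _ _ "{0<..}"]) (use 2 in auto)
    then show ?thesis using 2 by simp
  next
    case 3
    have "(\<lambda>h::real. (max 0 h)\<^sup>2 / h) \<midarrow>0\<rightarrow> 0"
    proof (rule Lim_null_comparison)
      show "\<forall>\<^sub>F h::real in at 0. norm ((max 0 h)\<^sup>2 / h) \<le> \<bar>h\<bar>"
        by (rule always_eventually) (auto simp: max_def power2_eq_square)
    qed (auto intro!: tendsto_eq_intros)
    then show ?thesis using 3 by (simp add: DERIV_def)
  qed
qed

lemma wt_has_derivative:
  "(wt has_derivative (\<lambda>h. - 4 * max 0 (1 - z \<bullet> z) * (z \<bullet> h))) (at z)"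
proof -
  have "((\<lambda>z. (max 0 (1 - z \<bullet> z))\<^sup>2) has_derivative
      (\<lambda>h. (- (z \<bullet> h + h \<bullet> z)) * (2 * max 0 (1 - z \<bullet> z)))) (at z)"
    by (rule has_derivative_compose[OF _ DERIV_max_0_square[unfolded has_field_derivative_def],
          THEN has_derivative_eq_rhs])
      (auto intro!: derivative_eq_intros simp: fun_eq_iff)
  then show ?thesis
    unfolding wt_def[abs_def]
    by (rule has_derivative_eq_rhs) (auto simp: fun_eq_iff inner_commute algebra_simps)
qed

lemma wt_eq_0: "norm z \<ge> 1 \<Longrightarrow> wt z = 0"
proof -
  assume "norm z \<ge> 1"
  then have "z \<bullet> z \<ge> 1" by (simp add: dot_square_norm)
  then show ?thesis by (simp add: wt_def max_def)
qed

lemma continuous_on_wt [continuous_intros]: "continuous_on S wt"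
  unfolding wt_def[abs_def] by (intro continuous_intros)

lemma integral_wt_pos: "integral (cube 2) (wt :: real ^ 'n \<Rightarrow> real) > 0"
proof -
  have 0: "(0::real ^ 'n) \<in> box (\<chi> i. -2) (\<chi> i. 2)" by (simp add: mem_box_cart)
  have "integral (cube 2) (wt :: real ^ 'n \<Rightarrow> real) \<noteq> 0"
  proof (subst integral_cbox_eq_0_iff)
    show "\<not> (\<forall>x\<in>cube 2. wt (x :: real ^ 'n) = 0)"
      using 0 by (auto intro!: bexI[of _ 0] simp: wt_def mem_cube)
  qed (use 0 in \<open>auto intro!: continuous_intros simp: wt_def\<close>)
  moreover have "integral (cube 2) (wt :: real ^ 'n \<Rightarrow> real) \<ge> 0"
    by (rule integral_nonneg) (auto intro!: integrable_continuous continuous_intros simp: wt_def)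
  ultimately show ?thesis by simp
qed

text \<open>The product of \<open>c\<close> with the rescaled \<open>F\<close> vanishes outside the
  unit ball, so \<open>integral_partial_eq_0\<close> applies to it; the factor \<open>t\<close> is
  the chain rule for \<open>x + t *\<^sub>R z\<close>.\<close>

lemma integral_by_parts:
  fixes F :: "(real, 'n::{finite,linorder}) vec \<Rightarrow> 'n clifford"
  assumes F: "left_clifford_holomorphic_on F U"
    and U: "\<And>z. z \<in> cube 3 \<Longrightarrow> x + t *\<^sub>R z \<in> U"
    and c: "\<And>z. (c has_derivative c' z) (at z)" "continuous_on UNIV (\<lambda>z. c' z (axis j 1))"
    and zero: "\<And>z. norm z \<ge> 1 \<Longrightarrow> c z = 0"
  shows "t *\<^sub>R integral (cube 2) (\<lambda>z. c z *\<^sub>R partial F j (x + t *\<^sub>R z))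
       = - integral (cube 2) (\<lambda>z. c' z (axis j 1) *\<^sub>R F (x + t *\<^sub>R z))"
proof -
  let ?e = "axis j 1 :: (real, 'n) vec"
  let ?H' = "\<lambda>z h. c z *\<^sub>R (t *\<^sub>R (\<Sum>j\<in>UNIV. h $ j *\<^sub>R partial F j (x + t *\<^sub>R z)))
      + c' z h *\<^sub>R F (x + t *\<^sub>R z)"
  have He: "?H' z ?e = t *\<^sub>R c z *\<^sub>R partial F j (x + t *\<^sub>R z) + c' z ?e *\<^sub>R F (x + t *\<^sub>R z)" for z
    by (simp add: sum_axis_scaleR)
  have cc: "continuous_on S c" for S
    using c(1) by (meson continuous_at_imp_continuous_on has_derivative_continuous)
  have 1: "continuous_on (cube 3) (\<lambda>z. c z *\<^sub>R partial F j (x + t *\<^sub>R z))"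
    by (intro continuous_intros cc continuous_on_compose2[OF holo_continuous_partial[OF F]])
      (auto intro: U)
  have 2: "continuous_on (cube 3) (\<lambda>z. c' z ?e *\<^sub>R F (x + t *\<^sub>R z))"
    by (intro continuous_intros continuous_on_compose2[OF holo_continuous[OF F]]
        continuous_on_subset[OF c(2)]) (auto intro: U)
  note sub = cube_mono[of 2 3]
  have "integral (cube 2) (\<lambda>z. ?H' z ?e) = 0"
  proof (rule integral_partial_eq_0[where H = "\<lambda>z. c z *\<^sub>R F (x + t *\<^sub>R z)"])
    fix z :: "(real, 'n) vec" assume "z \<in> cube 3"
    have "((\<lambda>z. F (x + t *\<^sub>R z)) has_derivative
        (\<lambda>h. \<Sum>j\<in>UNIV. (t *\<^sub>R h) $ j *\<^sub>R partial F j (x + t *\<^sub>R z))) (at z)"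
      by (rule has_derivative_affine_compose[OF holo_has_derivative[OF F U[OF \<open>z \<in> cube 3\<close>]]])
    then show "((\<lambda>z. c z *\<^sub>R F (x + t *\<^sub>R z)) has_derivative ?H' z) (at z)"
      by (intro has_derivative_eq_rhs[OF has_derivative_scaleR[OF c(1)]])
        (auto simp: scaleR_sum_right)
  next
    show "continuous_on (cube 3) (\<lambda>z. ?H' z ?e)"
      unfolding He using continuous_on_add[OF continuous_on_scaleR[OF continuous_on_const 1] 2] .
  qed (use zero in auto)
  also have "(\<lambda>z. ?H' z ?e) = (\<lambda>z. t *\<^sub>R c z *\<^sub>R partial F j (x + t *\<^sub>R z) + c' z ?e *\<^sub>R F (x + t *\<^sub>R z))"
    by (simp only: He)
  also have "integral (cube 2) \<dots> = t *\<^sub>R integral (cube 2) (\<lambda>z. c z *\<^sub>R partial F j (x + t *\<^sub>R z))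
      + integral (cube 2) (\<lambda>z. c' z ?e *\<^sub>R F (x + t *\<^sub>R z))"
    unfolding integral_cmul[symmetric]
    by (intro integral_add integrable_continuous continuous_on_subset[OF 2 sub]
        continuous_on_scaleR[OF continuous_on_const continuous_on_subset[OF 1 sub]]) auto
  finally show ?thesis by (simp add: eq_neg_iff_add_eq_0)
qed

section \<open>The mean value property\<close>

context
  fixes F :: "(real, 'n::{finite,linorder}) vec \<Rightarrow> 'n clifford" and U S :: "(real, 'n) vec set"
    and c :: "(real, 'n) vec \<Rightarrow> real" and t :: real
  assumes F: "left_clifford_holomorphic_on F U"
    and c: "continuous_on UNIV c"
    and U: "\<And>y z. y \<in> S \<Longrightarrow> z \<in> cube 2 \<Longrightarrow> y + t *\<^sub>R z \<in> U"
begin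

lemma continuous_weighted_partial:
  "continuous_on (S \<times> cube 2) (\<lambda>(y, z). c z *\<^sub>R partial F j (y + t *\<^sub>R z))"
  unfolding case_prod_unfold
  by (intro continuous_intros continuous_on_compose2[OF holo_continuous_partial[OF F]]
      continuous_on_compose2[OF c]) (auto intro: U)

lemma integrable_weighted_partial:
  assumes "y \<in> S"
  shows "(\<lambda>z. c z *\<^sub>R partial F j (y + t *\<^sub>R z)) integrable_on cube 2"
  by (intro integrable_continuous continuous_intros continuous_on_compose2[OF c]
      continuous_on_compose2[OF holo_continuous_partial[OF F]]) (auto intro: U[OF assms])

lemma integrable_weighted:
  assumes "y \<in> S"
  shows "(\<lambda>z. c z *\<^sub>R F (y + t *\<^sub>R z)) integrable_on cube 2"
  by (intro integrable_continuous continuous_intros continuous_on_compose2[OF c]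
      continuous_on_compose2[OF holo_continuous[OF F]]) (auto intro: U[OF assms])

lemma continuous_weighted_partial_integral:
  "continuous_on S (\<lambda>y. integral (cube 2) (\<lambda>z. c z *\<^sub>R partial F j (y + t *\<^sub>R z)))"
  by (rule integral_continuous_on_param[OF continuous_weighted_partial])

text \<open>The Dirac operator has constant coefficients, so it commutes with averaging over
  translates, whatever the weight. With derivatives of \<open>wt\<close> as weights this makes the
  partial derivatives of \<open>F\<close> satisfy the Dirac equation.\<close>

lemma Dirac_weighted_integral:
  assumes "y \<in> S"
  shows "(\<Sum>j\<in>UNIV. clmul (cl_gen j) (integral (cube 2) (\<lambda>z. c z *\<^sub>R partial F j (y + t *\<^sub>R z)))) = 0"
proof -
  note int = integrable_weighted_partial[OF assms]
  note lin = bounded_linear_clmul_gen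
  have "(\<Sum>j\<in>UNIV. clmul (cl_gen j) (integral (cube 2) (\<lambda>z. c z *\<^sub>R partial F j (y + t *\<^sub>R z))))
      = (\<Sum>j\<in>UNIV. integral (cube 2) (\<lambda>z. clmul (cl_gen j) (c z *\<^sub>R partial F j (y + t *\<^sub>R z))))"
    by (intro sum.cong refl) (rule integral_linear[OF int lin, symmetric, unfolded o_def])
  also have "\<dots> = integral (cube 2) (\<lambda>z. \<Sum>j\<in>UNIV. clmul (cl_gen j) (c z *\<^sub>R partial F j (y + t *\<^sub>R z)))"
    by (rule integral_sum[symmetric]) (auto intro: integrable_linear[OF int lin, unfolded o_def])
  also have "\<dots> = integral (cube 2) (\<lambda>z. c z *\<^sub>R (\<Sum>j\<in>UNIV. clmul (cl_gen j) (partial F j (y + t *\<^sub>R z))))"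
    by (simp add: clmul_gen_scaleR scaleR_sum_right)
  also have "\<dots> = integral (cube 2) (\<lambda>z::(real, 'n) vec. 0)"
    by (rule integral_cong) (simp add: holo_Dirac[OF F U[OF assms]])
  finally show ?thesis by simp
qed

lemma has_derivative_weighted_integral:
  assumes "convex S" "x \<in> S"
  shows "((\<lambda>y. integral (cube 2) (\<lambda>z. c z *\<^sub>R F (y + t *\<^sub>R z))) has_derivative
    (\<lambda>h. \<Sum>j\<in>UNIV. h $ j *\<^sub>R integral (cube 2) (\<lambda>z. c z *\<^sub>R partial F j (x + t *\<^sub>R z))))
    (at x within S)"
proof -
  \<comment> \<open>The total derivative as a \<open>blinfun\<close>-valued map, the form in which
    \<open>leibniz_rule\<close> takes its integrand; its continuity is reduced to that of the
    partial derivatives.\<close>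
  define D where "D y = Blinfun (\<lambda>h. \<Sum>j\<in>UNIV. h $ j *\<^sub>R partial F j y)" for y
  have D: "D y h = (\<Sum>j\<in>UNIV. h $ j *\<^sub>R partial F j y)" for y h
    unfolding D_def
    by (subst bounded_linear_Blinfun_apply)
      (intro bounded_linear_sum bounded_linear_scaleR_const[OF bounded_linear_vec_nth], rule refl)
  have contD: "continuous_on U D"
    by (intro continuous_on_blinfun_componentwise, unfold D)
      (intro continuous_on_sum continuous_on_scaleR continuous_on_const holo_continuous_partial[OF F])
  have cont: "continuous_on (S \<times> cube 2) (\<lambda>(y, z). c z *\<^sub>R D (y + t *\<^sub>R z))"
    unfolding case_prod_unfold
    by (intro continuous_intros continuous_on_compose2[OF contD]
        continuous_on_compose2[OF c]) (auto intro: U)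
  have deriv: "((\<lambda>y. integral (cube 2) (\<lambda>z. c z *\<^sub>R F (y + t *\<^sub>R z))) has_derivative
      integral (cube 2) (\<lambda>z. c z *\<^sub>R D (x + t *\<^sub>R z))) (at x within S)"
  proof (rule leibniz_rule[where fx = "\<lambda>y z. c z *\<^sub>R D (y + t *\<^sub>R z)", OF _ _ cont assms(2,1)])
    fix y z :: "(real, 'n) vec" assume yz: "y \<in> S" "z \<in> cube 2"
    have "(F has_derivative D (y + t *\<^sub>R z)) (at (y + t *\<^sub>R z))"
      by (rule has_derivative_eq_rhs[OF holo_has_derivative[OF F U[OF yz]]]) (simp add: D fun_eq_iff)
    then have "((\<lambda>y. F (y + t *\<^sub>R z)) has_derivative (\<lambda>h. D (y + t *\<^sub>R z) h)) (at y within S)"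
      by (intro has_derivative_compose[where f = "\<lambda>y. y + t *\<^sub>R z" and g = F])
        (auto intro!: derivative_eq_intros)
    then have "((\<lambda>y. c z *\<^sub>R F (y + t *\<^sub>R z)) has_derivative (\<lambda>h. c z *\<^sub>R D (y + t *\<^sub>R z) h))
        (at y within S)"
      by (rule has_derivative_scaleR_right)
    then show "((\<lambda>y. c z *\<^sub>R F (y + t *\<^sub>R z)) has_derivative blinfun_apply (c z *\<^sub>R D (y + t *\<^sub>R z)))
        (at y within S)"
      by (simp add: scaleR_blinfun.rep_eq)
  qed (rule integrable_weighted)
  have apply_h: "integral (cube 2) (\<lambda>z. c z *\<^sub>R D (x + t *\<^sub>R z)) h
      = (\<Sum>j\<in>UNIV. h $ j *\<^sub>R integral (cube 2) (\<lambda>z. c z *\<^sub>R partial F j (x + t *\<^sub>R z)))" for h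
  proof -
    have "(\<lambda>z. c z *\<^sub>R D (x + t *\<^sub>R z)) integrable_on cube 2"
      by (intro integrable_continuous continuous_intros continuous_on_compose2[OF c]
          continuous_on_compose2[OF contD]) (auto intro: U[OF assms(2)])
    then have "integral (cube 2) (\<lambda>z. c z *\<^sub>R D (x + t *\<^sub>R z)) h
        = integral (cube 2) (\<lambda>z. (\<Sum>j\<in>UNIV. h $ j *\<^sub>R c z *\<^sub>R partial F j (x + t *\<^sub>R z)))"
      by (simp add: blinfun_apply_integral scaleR_blinfun.rep_eq D scaleR_sum_right
          mult.commute[of "c _"])
    also have "\<dots> = (\<Sum>j\<in>UNIV. h $ j *\<^sub>R integral (cube 2) (\<lambda>z. c z *\<^sub>R partial F j (x + t *\<^sub>R z)))"
      unfolding integral_cmul[symmetric]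
      by (intro integral_sum integrable_cmul integrable_weighted_partial assms) simp
    finally show ?thesis .
  qed
  show ?thesis by (rule has_derivative_eq_rhs[OF deriv]) (simp add: fun_eq_iff apply_h)
qed

end

text \<open>The derivative in \<open>t\<close> of the weighted mean over the ball of radius \<open>t\<close> is the trace of
  \<open>T i j = \<integral> wt z * z $ i * partial F j (x + t z) dz\<close>.  Integration by parts shows that \<open>T\<close> is
  symmetric because the weight is radial; as \<open>\<Sum>i j. e_i e_j T i j\<close> vanishes by the Dirac
  equation, the anticommutation relations force the trace to vanish.\<close>
lemma weighted_mean_value:
  fixes F :: "(real, 'n::{finite,linorder}) vec \<Rightarrow> 'n clifford"
  assumes F: "left_clifford_holomorphic_on F U" and r: "r \<ge> 0"
    and U: "\<And>z t. z \<in> cube 3 \<Longrightarrow> 0 \<le> t \<Longrightarrow> t \<le> r \<Longrightarrow> x + t *\<^sub>R z \<in> U"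
  shows "integral (cube 2) (\<lambda>z. wt z *\<^sub>R F (x + r *\<^sub>R z)) = integral (cube 2) (wt :: (real, 'n) vec \<Rightarrow> real) *\<^sub>R F x"
proof -
  define A where "A t = integral (cube 2) (\<lambda>z. wt z *\<^sub>R F (x + t *\<^sub>R z))" for t
  define T where "T t i j = integral (cube 2) (\<lambda>z. (wt z * z $ i) *\<^sub>R partial F j (x + t *\<^sub>R z))" for t i j
  have U2: "x + t *\<^sub>R z \<in> U" if "z \<in> cube 2" "t \<in> {0..r}" for z t
    using U[of z t] that cube_mono[of 2 3] by auto
  have sum_eq: "(\<Sum>j\<in>UNIV. T t j j) = integral (cube 2)
      (\<lambda>z. wt z *\<^sub>R (\<Sum>j\<in>UNIV. z $ j *\<^sub>R partial F j (x + t *\<^sub>R z)))" if "t \<in> {0..r}" for t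
  proof -
    have "(\<Sum>j\<in>UNIV. T t j j) = integral (cube 2)
      (\<lambda>z. \<Sum>j\<in>UNIV. (wt z * z $ j) *\<^sub>R partial F j (x + t *\<^sub>R z))"
      unfolding T_def
      by (rule integral_sum[symmetric], simp)
        (intro integrable_weighted_partial[OF F, where S = "{x}"] continuous_intros; use U2 that in auto)
    then show ?thesis by (simp add: scaleR_sum_right)
  qed
  have deriv: "(A has_vector_derivative (\<Sum>j\<in>UNIV. T t j j)) (at t within {0..r})"
    if t: "t \<in> {0..r}" for t
    unfolding sum_eq[OF t] A_def
  proof (rule leibniz_rule_vector_derivative[where
        fx = "\<lambda>t z. wt z *\<^sub>R (\<Sum>j\<in>UNIV. z $ j *\<^sub>R partial F j (x + t *\<^sub>R z))"])
    fix t :: real and z :: "(real, 'n) vec" assume "t \<in> {0..r}" "z \<in> cube 2"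
    then show "((\<lambda>t. wt z *\<^sub>R F (x + t *\<^sub>R z)) has_vector_derivative
        wt z *\<^sub>R (\<Sum>j\<in>UNIV. z $ j *\<^sub>R partial F j (x + t *\<^sub>R z))) (at t within {0..r})"
      by (intro bounded_linear.has_vector_derivative[OF bounded_linear_scaleR_right]
          has_vector_derivative_line_compose
          holo_has_derivative[OF F] U2)
  next
    fix t assume "t \<in> {0..r}"
    then show "(\<lambda>z. wt z *\<^sub>R F (x + t *\<^sub>R z)) integrable_on cube 2"
      by (intro integrable_weighted[OF F, where S = "{x}"] continuous_intros) (use U2 in auto)
  next
    show "continuous_on ({0..r} \<times> cube 2)
        (\<lambda>(t, z). wt z *\<^sub>R (\<Sum>j\<in>UNIV. z $ j *\<^sub>R partial F j (x + t *\<^sub>R z)))"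
      unfolding case_prod_unfold
      by (intro continuous_intros continuous_on_compose2[OF holo_continuous_partial[OF F]]
          continuous_on_compose2[OF continuous_on_wt[of UNIV]]) (auto intro: U2)
  qed (use t in auto)
  \<comment> \<open>Restricted to \<open>t > 0\<close> because integration by parts yields only
    \<open>t *\<^sub>R T t i j\<close>. Its right-hand side contains the indices only through the
    Kronecker delta and \<open>z $ i * z $ j\<close>, so symmetry can be read off.\<close>
  have trace: "(\<Sum>j\<in>UNIV. T t j j) = 0" if t: "t \<in> {0<..r}" for t
  proof -
    let ?c' = "\<lambda>i z h. wt z * h $ i + (- 4 * max 0 (1 - z \<bullet> z) * (z \<bullet> h)) * z $ i"
    have "t *\<^sub>R T t i j = - integral (cube 2)
        (\<lambda>z. (wt z * (if i = j then 1 else 0) - 4 * max 0 (1 - z \<bullet> z) * (z $ i * z $ j)) *\<^sub>R F (x + t *\<^sub>R z))"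
      for i j
      unfolding T_def
    proof (subst integral_by_parts[OF F, where c' = "?c' i"])
      fix z :: "(real, 'n) vec"
      show "((\<lambda>z. wt z * z $ i) has_derivative ?c' i z) (at z)"
        by (intro has_derivative_mult wt_has_derivative)
          (auto intro: bounded_linear_imp_has_derivative bounded_linear_vec_nth)
      show "wt z * z $ i = 0" if "1 \<le> norm z" using that by (simp add: wt_eq_0)
      show "x + t *\<^sub>R z \<in> U" if "z \<in> cube 3" using U that t by auto
    next
      show "continuous_on UNIV (\<lambda>z. ?c' i z (axis j 1))"
        by (intro continuous_intros)
    next
      have "?c' i z (axis j 1) = wt z * (if i = j then 1 else 0) - 4 * max 0 (1 - z \<bullet> z) * (z $ i * z $ j)" for z
        using inner_axis[of z j 1] by (simp add: axis_def)
      then show "- integral (cube 2) (\<lambda>z. ?c' i z (axis j 1) *\<^sub>R F (x + t *\<^sub>R z)) = - integral (cube 2)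
        (\<lambda>z. (wt z * (if i = j then 1 else 0) - 4 * max 0 (1 - z \<bullet> z) * (z $ i * z $ j)) *\<^sub>R F (x + t *\<^sub>R z))"
        by (simp only:)
    qed
    note T_eq = this
    have "t *\<^sub>R T t i j = t *\<^sub>R T t j i" for i j
      unfolding T_eq mult.commute[of "_ $ i" "_ $ j"] eq_commute[of i j] ..
    then have sym: "T t i j = T t j i" for i j using t by simp
    have "(\<Sum>j\<in>UNIV. clmul (cl_gen j) (T t i j)) = 0" for i
      unfolding T_def
      by (rule Dirac_weighted_integral[OF F, where S = "{x}"])
        (use U2 t in \<open>auto intro!: continuous_intros\<close>)
    then have "(\<Sum>i\<in>UNIV. \<Sum>j\<in>UNIV. clmul (cl_gen i) (clmul (cl_gen j) (T t i j))) = 0"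
      by (simp add: clmul_gen_zero flip: clmul_gen_sum)
    then show ?thesis using clmul_gen_symmetric_sum[of "T t", OF sym] by simp
  qed
  have "A r = A 0"
  \<comment> \<open>The exceptional set \<open>{0}\<close> takes care of the endpoint where
    \<open>trace\<close> says nothing; continuity of \<open>A\<close> suffices there.\<close>
  proof (rule has_derivative_zero_unique_strong_interval[of "{0}" 0 r A "A 0" r])
    show "continuous_on {0..r} A"
      using deriv by (meson continuous_on_eq_continuous_within has_vector_derivative_continuous)
    show "(A has_derivative (\<lambda>h. 0)) (at t within {0..r})" if "t \<in> {0..r} - {0}" for t
    proof -
      have "t \<in> {0..r}" "t \<in> {0<..r}" using that by auto
      from deriv[OF this(1)] trace[OF this(2)] show ?thesis by (simp add: has_vector_derivative_def)
    qed
  qed (use r in auto)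
  also have "A 0 = integral (cube 2) (wt :: (real, 'n) vec \<Rightarrow> real) *\<^sub>R F x"
  proof -
    have "(wt :: (real, 'n) vec \<Rightarrow> real) integrable_on cube 2"
      by (intro integrable_continuous continuous_on_wt)
    from integral_unique[OF has_integral_scaleR_left[OF integrable_integral[OF this]]]
    show ?thesis by (simp add: A_def)
  qed
  finally show ?thesis by (simp add: A_def)
qed

section \<open>Regularity and Cauchy estimates\<close>

text \<open>The \<open>j\<close>-th partial derivative of \<open>wt\<close>, as given by
  \<open>wt_has_derivative\<close>.\<close>

definition dwt :: "'n \<Rightarrow> real ^ 'n \<Rightarrow> real" where
  "dwt j z = - 4 * max 0 (1 - z \<bullet> z) * z $ j"

lemma continuous_on_dwt [continuous_intros]: "continuous_on S (dwt j)"
  unfolding dwt_def[abs_def] by (intro continuous_intros)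

lemma partial_transform_open:
  assumes "open S" "x \<in> S" "\<And>y. y \<in> S \<Longrightarrow> F y = G y" "(G has_derivative G') (at x)"
  shows "(F has_derivative G') (at x)" "partial F j x = G' (axis j 1)"
proof -
  show "(F has_derivative G') (at x)"
    using has_derivative_transform_within_open[OF assms(4,1,2)] assms(3) by metis
  then show "partial F j x = G' (axis j 1)" by (rule partial_eq)
qed

text \<open>Differentiate the mean value formula in its centre, then shift the derivative to the
  weight. A derivative of \<open>F\<close> is thereby expressed through values of \<open>F\<close>
  alone, which gives both regularity and the Cauchy estimate.\<close>

lemma partial_weighted_mean:
  fixes F :: "(real, 'n::{finite,linorder}) vec \<Rightarrow> 'n clifford"
  assumes F: "left_clifford_holomorphic_on F U" and r: "r > 0"
    and U: "cball x (r * (3 * real CARD('n) + 1)) \<subseteq> U"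
  shows "partial F j x = (- 1 / (r * integral (cube 2) (wt :: (real, 'n) vec \<Rightarrow> real))) *\<^sub>R
    integral (cube 2) (\<lambda>z. dwt j z *\<^sub>R F (x + r *\<^sub>R z))"
proof -
  let ?I = "integral (cube 2) (wt :: (real, 'n) vec \<Rightarrow> real)"
  have I: "?I > 0" by (rule integral_wt_pos)
  \<comment> \<open>Origin of the factor 3 n + 1: points of \<open>cube 3\<close> have norm at most
    3 n, and the centre itself moves by up to \<open>r\<close>.\<close>
  have U3: "y + t *\<^sub>R z \<in> U" if "y \<in> ball x r" "z \<in> cube 3" "0 \<le> t" "t \<le> r" for y z t
  proof -
    have "norm (t *\<^sub>R z) \<le> r * (3 * real CARD('n))"
      using norm_le_of_mem_cube[OF that(2)] that by (simp add: mult_mono)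
    moreover have "norm (y - x) \<le> r" using that by (simp add: dist_norm norm_minus_commute)
    moreover have "norm ((y + t *\<^sub>R z) - x) \<le> norm (y - x) + norm (t *\<^sub>R z)"
      using norm_triangle_ineq[of "y - x" "t *\<^sub>R z"] by (simp add: algebra_simps)
    ultimately have "y + t *\<^sub>R z \<in> cball x (r * (3 * real CARD('n) + 1))"
      by (simp add: dist_norm norm_minus_commute algebra_simps)
    then show ?thesis using U by blast
  qed
  have x: "x \<in> ball x r" using r by simp
  have "((\<lambda>y. integral (cube 2) (\<lambda>z. wt z *\<^sub>R F (y + r *\<^sub>R z))) has_derivative
    (\<lambda>h. \<Sum>j\<in>UNIV. h $ j *\<^sub>R integral (cube 2) (\<lambda>z. wt z *\<^sub>R partial F j (x + r *\<^sub>R z))))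
    (at x within ball x r)"
    by (rule has_derivative_weighted_integral[OF F])
      (use U3 cube_mono[of 2 3] x r in \<open>auto intro!: continuous_intros\<close>)
  then have "((\<lambda>y. (1 / ?I) *\<^sub>R integral (cube 2) (\<lambda>z. wt z *\<^sub>R F (y + r *\<^sub>R z))) has_derivative
    (\<lambda>h. (1 / ?I) *\<^sub>R (\<Sum>j\<in>UNIV. h $ j *\<^sub>R integral (cube 2) (\<lambda>z. wt z *\<^sub>R partial F j (x + r *\<^sub>R z)))))
    (at x)"
    using at_within_open[OF x] by (auto intro: has_derivative_scaleR_right)
  moreover have "F y = (1 / ?I) *\<^sub>R integral (cube 2) (\<lambda>z. wt z *\<^sub>R F (y + r *\<^sub>R z))"
    if "y \<in> ball x r" for y
    using weighted_mean_value[OF F, of r y] U3[OF that] r I by simp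
  ultimately have "partial F j x = (1 / ?I) *\<^sub>R integral (cube 2) (\<lambda>z. wt z *\<^sub>R partial F j (x + r *\<^sub>R z))"
    using partial_transform_open(2)[OF open_ball x] by (simp only: sum_axis_scaleR)
  moreover have "r *\<^sub>R integral (cube 2) (\<lambda>z. wt z *\<^sub>R partial F j (x + r *\<^sub>R z))
      = - integral (cube 2) (\<lambda>z. dwt j z *\<^sub>R F (x + r *\<^sub>R z))"
  proof -
    have "(\<lambda>z. - 4 * max 0 (1 - z \<bullet> z) * (z \<bullet> axis j 1)) = dwt j"
      by (simp add: fun_eq_iff dwt_def inner_axis)
    then show ?thesis
      using integral_by_parts[OF F, where x = x and t = r and c = wt and j = j, OF U3[OF x] wt_has_derivative _ wt_eq_0]
        r continuous_on_dwt[of UNIV j] by (simp add: fun_eq_iff)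
  qed
  moreover have "P = (- 1 / (r * ?I)) *\<^sub>R K"
    if "P = (1 / ?I) *\<^sub>R J" "r *\<^sub>R J = - K" for P J K :: "'n clifford"
  proof -
    have "P = (1 / ?I) *\<^sub>R (1 / r) *\<^sub>R (r *\<^sub>R J)" using r that(1) by simp
    then show ?thesis unfolding that(2) by (simp add: mult.commute)
  qed
  ultimately show ?thesis by blast
qed

text \<open>Locally \<open>partial F j\<close> is a weighted mean of \<open>F\<close> with a radius
  that does not depend on the centre, so it can be differentiated under the integral once more and
  inherits the Dirac equation from \<open>F\<close>.\<close>

lemma left_clifford_holomorphic_on_partial:
  fixes F :: "(real, 'n::{finite,linorder}) vec \<Rightarrow> 'n clifford"
  assumes F: "left_clifford_holomorphic_on F U"
  shows "left_clifford_holomorphic_on (partial F j) U"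
proof -
  let ?G = "partial F j"
  have main: "\<exists>S. open S \<and> x \<in> S \<and> ?G differentiable (at x) \<and> (\<forall>k. continuous_on S (partial ?G k)) \<and>
      (\<Sum>k\<in>UNIV. clmul (cl_gen k) (partial ?G k x)) = 0" if "x \<in> U" for x
  proof -
    \<comment> \<open>One more than the 3 n + 1 of \<open>partial_weighted_mean\<close>, since that
      lemma is applied at every centre in \<open>ball x r\<close> with the same
      \<open>r\<close>.\<close>
    let ?\<kappa> = "3 * real CARD('n) + 2"
    obtain e where e: "e > 0" "cball x e \<subseteq> U"
      using holo_open[OF F] \<open>x \<in> U\<close> by (meson open_contains_cball)
    define r where "r = e / ?\<kappa>"
    have \<kappa>: "?\<kappa> > 0" by (simp add: add_nonneg_pos)
    then have r: "r > 0" and re: "r * ?\<kappa> = e" using e by (simp_all add: r_def)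
    define S where "S = ball x r"
    have S: "open S" "x \<in> S" "convex S" using r by (simp_all add: S_def)
    have sub: "cball y (r * (3 * real CARD('n) + 1)) \<subseteq> U" if "y \<in> S" for y
    proof -
      have "cball y (r * (3 * real CARD('n) + 1)) \<subseteq> cball x e"
        unfolding re[symmetric] using that
        by (intro cball_subset_cball_iff[THEN iffD2]) (simp add: S_def dist_commute algebra_simps)
      then show ?thesis using e by blast
    qed
    have SU: "y + r *\<^sub>R z \<in> U" if "y \<in> S" "z \<in> cube 2" for y z
    proof -
      have "norm z \<le> 2 * real CARD('n)" using norm_le_of_mem_cube[OF that(2)] .
      also have "\<dots> \<le> 3 * real CARD('n) + 1" by simp
      finally have "y + r *\<^sub>R z \<in> cball y (r * (3 * real CARD('n) + 1))"
        using r by (simp add: dist_norm)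
      then show ?thesis using sub[OF that(1)] by blast
    qed
    define a where "a = - 1 / (r * integral (cube 2) (wt :: (real, 'n) vec \<Rightarrow> real))"
    have G: "?G y = a *\<^sub>R integral (cube 2) (\<lambda>z. dwt j z *\<^sub>R F (y + r *\<^sub>R z))" if "y \<in> S" for y
      unfolding a_def by (rule partial_weighted_mean[OF F r sub[OF that]])
    have "((\<lambda>y. a *\<^sub>R integral (cube 2) (\<lambda>z. dwt j z *\<^sub>R F (y + r *\<^sub>R z))) has_derivative
      (\<lambda>h. a *\<^sub>R (\<Sum>k\<in>UNIV. h $ k *\<^sub>R integral (cube 2) (\<lambda>z. dwt j z *\<^sub>R partial F k (y + r *\<^sub>R z)))))
      (at y)" if "y \<in> S" for y
      using has_derivative_weighted_integral[OF F continuous_on_dwt SU S(3) that]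
        at_within_open[OF that S(1)] by (auto intro: has_derivative_scaleR_right)
    note D = partial_transform_open[OF S(1) _ G this]
    have P: "partial ?G k y = a *\<^sub>R integral (cube 2) (\<lambda>z. dwt j z *\<^sub>R partial F k (y + r *\<^sub>R z))"
      if "y \<in> S" for k y by (simp only: D(2)[OF that _ that] sum_axis_scaleR)
    show ?thesis
    proof (intro exI[of _ S] conjI S allI)
      show "?G differentiable (at x)" using D(1)[OF S(2) _ S(2)] by (auto simp: differentiable_def)
      show "continuous_on S (partial ?G k)" for k
        by (rule continuous_on_eq[OF _ P[of _ k, symmetric]])
          (intro continuous_intros continuous_weighted_partial_integral[OF F continuous_on_dwt SU])
      show "(\<Sum>k\<in>UNIV. clmul (cl_gen k) (partial ?G k x)) = 0"
        using Dirac_weighted_integral[OF F continuous_on_dwt SU S(2)]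
        by (simp add: P[OF S(2)] clmul_gen_scaleR flip: scaleR_sum_right)
    qed
  qed
  have "continuous_on U (partial ?G k)" for k
  proof (rule continuous_at_imp_continuous_on, rule ballI)
    fix x assume "x \<in> U"
    from main[OF this] show "isCont (partial ?G k) x" by (meson continuous_on_eq_continuous_at)
  qed
  with main holo_open[OF F] show ?thesis
    unfolding left_clifford_holomorphic_on_def by blast
qed

text \<open>The quantifier order matters: \<open>C\<close> depends on the dimension only, so the
  estimate can be iterated on higher derivatives and on balls of any size.\<close>

lemma holo_partial_bound:
  "\<exists>C>0. \<forall>(F :: (real, 'n::{finite,linorder}) vec \<Rightarrow> 'n clifford) U x r M j.
     left_clifford_holomorphic_on F U \<longrightarrow> r > 0 \<longrightarrow> cball x r \<subseteq> U \<longrightarrow>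
     (\<forall>y\<in>cball x r. norm (F y) \<le> M) \<longrightarrow> norm (partial F j x) \<le> C * M / r"
proof -
  let ?I = "integral (cube 2) (wt :: (real, 'n) vec \<Rightarrow> real)"
  let ?\<kappa> = "3 * real CARD('n) + 1"
  let ?V = "measure lborel (cube 2 :: (real, 'n) vec set)"
  have I: "?I > 0" by (rule integral_wt_pos)
  have \<kappa>: "?\<kappa> > 0" by (simp add: add_nonneg_pos)
  \<comment> \<open>On \<open>cube 2\<close> the weight satisfies |dwt| <= 4 * 1 * 2 = 8,
    \<open>?V\<close> is the volume, and \<open>?\<kappa>\<close> converts the averaging radius into
    \<open>r\<close>. The added 1 makes positivity immediate.\<close>
  define C where "C = (8 * ?V * ?\<kappa>) / ?I + 1"
  have "C > 0" unfolding C_def using I \<kappa> by (intro add_nonneg_pos) auto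
  moreover have "norm (partial F j x) \<le> C * M / r"
    if F: "left_clifford_holomorphic_on F U" and r: "r > 0" and U: "cball x r \<subseteq> U"
      and M: "\<And>y. y \<in> cball x r \<Longrightarrow> norm (F y) \<le> M"
    for F :: "(real, 'n) vec \<Rightarrow> 'n clifford" and U x r M j
  proof -
    define s where "s = r / ?\<kappa>"
    have s: "s > 0" "s * ?\<kappa> = r" using r \<kappa> by (simp_all add: s_def)
    have mem: "x + s *\<^sub>R z \<in> cball x r" if "z \<in> cube 2" for z
    proof -
      have "norm z \<le> 2 * real CARD('n)" using norm_le_of_mem_cube[OF that] .
      also have "\<dots> \<le> ?\<kappa>" by simp
      finally show ?thesis unfolding s(2)[symmetric] using s(1) by (simp add: dist_norm)
    qed
    have M0: "M \<ge> 0" using M[of x] r by (auto intro: order_trans[OF norm_ge_zero])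
    have "norm (integral (cube 2) (\<lambda>z. dwt j z *\<^sub>R F (x + s *\<^sub>R z))) \<le> (8 * M) * ?V"
    proof (rule has_integral_bound)
      show "((\<lambda>z. dwt j z *\<^sub>R F (x + s *\<^sub>R z)) has_integral
          integral (cube 2) (\<lambda>z. dwt j z *\<^sub>R F (x + s *\<^sub>R z))) (cube 2)"
        by (intro integrable_integral integrable_weighted[OF F, where S = "{x}"] continuous_on_dwt)
          (use mem U in auto)
      fix z :: "(real, 'n) vec" assume z: "z \<in> cube 2"
      have "\<bar>max 0 (1 - z \<bullet> z)\<bar> \<le> 1" by auto
      moreover have "\<bar>z $ j\<bar> \<le> 2" using z by (simp add: mem_cube)
      ultimately have "\<bar>max 0 (1 - z \<bullet> z)\<bar> * \<bar>z $ j\<bar> \<le> 1 * 2" by (intro mult_mono) auto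
      then have "\<bar>dwt j z\<bar> \<le> 8" by (simp add: dwt_def abs_mult mult.commute)
      then show "norm (dwt j z *\<^sub>R F (x + s *\<^sub>R z)) \<le> 8 * M"
        using M[OF mem[OF z]] by (simp add: mult_mono)
    qed (use M0 in auto)
    then have "norm (partial F j x) \<le> (1 / (s * ?I)) * ((8 * M) * ?V)"
      using s I by (subst partial_weighted_mean[OF F s(1)])
        (use U in \<open>auto simp: s(2) abs_mult divide_right_mono\<close>)
    also have "\<dots> = (8 * ?V * ?\<kappa> / ?I) * M / r" unfolding s_def using \<kappa> r I by (simp add: field_simps)
    also have "\<dots> \<le> C * M / r"
      unfolding C_def using M0 r by (intro divide_right_mono mult_right_mono) auto
    finally show ?thesis .
  qed
  ultimately show ?thesis by blast
qed

section \<open>Local uniqueness\<close>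

text \<open>k^k / k! is a single term of the exponential series for exp k.\<close>

lemma power_self_le_exp_fact: "real k ^ k \<le> exp 1 ^ k * fact k"
proof -
  have "real k ^ k / fact k = (\<Sum>n\<in>{k}. real k ^ n /\<^sub>R fact n)" by (simp add: divide_inverse)
  also have "\<dots> \<le> (\<Sum>n. real k ^ n /\<^sub>R fact n)"
    by (intro sum_le_suminf summable_exp_generic) auto
  also have "\<dots> = exp (real k * 1)" by (simp add: exp_def)
  also have "\<dots> = exp 1 ^ k" by (rule exp_of_nat_mult)
  finally show ?thesis by (simp add: field_simps)
qed

text \<open>Constancy along the sphere kills the tangential derivatives, and then the Dirac equation
  reduces to Clifford multiplication of the normal derivative by the unit normal.\<close>
lemma holo_partial_eq_0_on_sphere:
  fixes F :: "(real, 'n::{finite,linorder}) vec \<Rightarrow> 'n clifford"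
  assumes F: "left_clifford_holomorphic_on F U"
    and zero: "\<And>x. x \<in> sphere 0 1 \<inter> U \<Longrightarrow> F x = 0" and p: "p \<in> sphere 0 1 \<inter> U"
  shows "partial F j p = 0"
proof -
  define F' where "F' h = (\<Sum>j\<in>UNIV. h $ j *\<^sub>R partial F j p)" for h
  have dF: "(F has_derivative F') (at p)"
    using holo_has_derivative[OF F, of p] p by (simp add: F'_def[abs_def])
  have np: "norm p = 1" using p by simp
  \<comment> \<open>The derivative at \<open>p\<close> of the radial retraction onto the sphere is
    the tangential projection. Composing \<open>F\<close> with the retraction gives a function that
    vanishes near \<open>p\<close>, so \<open>F'\<close> vanishes on tangent vectors.\<close>
  have ds: "((\<lambda>x. x /\<^sub>R norm x) has_derivative (\<lambda>h. h - (h \<bullet> p) *\<^sub>R p)) (at p)"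
    using np by (auto intro!: derivative_eq_intros has_derivative_norm[THEN has_derivative_eq_rhs]
        simp: fun_eq_iff sgn_div_norm inner_commute)
  have cont: "isCont (\<lambda>x. x /\<^sub>R norm x) p" using has_derivative_continuous[OF ds] .
  have d1: "((\<lambda>x. F (x /\<^sub>R norm x)) has_derivative (\<lambda>h. F' (h - (h \<bullet> p) *\<^sub>R p))) (at p)"
    by (rule has_derivative_compose[where g = F, OF ds]) (use dF np in simp)
  have d2: "((\<lambda>x. F (x /\<^sub>R norm x)) has_derivative (\<lambda>h. 0)) (at p)"
  proof (rule has_derivative_transform_eventually[of "\<lambda>_. 0"])
    have "\<forall>\<^sub>F x in nhds p. x /\<^sub>R norm x \<in> U"
      using cont holo_open[OF F] p np by (simp add: isCont_def eventually_nhds_conv_at topological_tendstoD)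
    moreover have "\<forall>\<^sub>F x in nhds p. x \<in> - {0}"
      by (rule eventually_nhds_in_open) (use np in auto)
    ultimately show "\<forall>\<^sub>F x in at p. 0 = F (x /\<^sub>R norm x)"
      unfolding eventually_at_filter by eventually_elim (auto simp: zero)
  qed (use p np zero in auto)
  have tangential: "F' (h - (h \<bullet> p) *\<^sub>R p) = 0" for h
    using fun_cong[OF has_derivative_unique[OF d1 d2], of h] .
  have F': "F' h = (h \<bullet> p) *\<^sub>R F' p" for h
    using tangential[of h]
    by (simp add: linear_diff[OF has_derivative_linear[OF dF]] linear_scale[OF has_derivative_linear[OF dF]])
  have P: "partial F i p = p $ i *\<^sub>R F' p" for i
    using partial_eq[OF dF, of i] F'[of "axis i 1"] by (simp add: inner_axis')
  \<comment> \<open>The Dirac equation at \<open>p\<close> says that the vector \<open>p\<close>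
    times \<open>F' p\<close> is zero; multiplying by \<open>p\<close> again and using p p = - |p|^2
    isolates \<open>F' p\<close>.\<close>
  have "(\<Sum>i\<in>UNIV. \<Sum>j\<in>UNIV. clmul (cl_gen i) (clmul (cl_gen j) ((p $ i * p $ j) *\<^sub>R F' p)))
      = (\<Sum>i\<in>UNIV. p $ i *\<^sub>R clmul (cl_gen i) (\<Sum>j\<in>UNIV. clmul (cl_gen j) (partial F j p)))"
    by (simp add: P clmul_gen_sum clmul_gen_scaleR scaleR_sum_right)
  also have "\<dots> = 0" using holo_Dirac[OF F, of p] p by (simp add: clmul_gen_zero)
  finally have "(\<Sum>i\<in>UNIV. (p $ i * p $ i) *\<^sub>R F' p) = 0"
    by (subst (asm) clmul_gen_symmetric_sum) (simp_all add: mult.commute)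
  then have "(p \<bullet> p) *\<^sub>R F' p = 0" by (simp add: inner_vec_def flip: scaleR_sum_left)
  then have "F' p = 0" using np by (simp add: dot_square_norm)
  then show ?thesis by (simp add: P)
qed

text \<open>Taylor's remainder estimate in inductive form. The partial derivatives of
  \<open>H\<close> satisfy the same hypotheses on a ball smaller by \<open>\<delta>\<close>, with
  \<open>M\<close> replaced by \<open>C * M / \<delta>\<close>. As \<open>H p = 0\<close>,
  integrating their bound along the segment from \<open>p\<close> to \<open>p + v\<close> adds one
  factor n |v| and one factor of the factorial.\<close>

lemma holo_vanishing_estimate:
  fixes H :: "(real, 'n::{finite,linorder}) vec \<Rightarrow> 'n clifford"
  assumes bound: "\<And>(F :: (real, 'n) vec \<Rightarrow> 'n clifford) x r M j.
      left_clifford_holomorphic_on F U \<Longrightarrow> r > 0 \<Longrightarrow> cball x r \<subseteq> U \<Longrightarrow>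
      \<forall>y\<in>cball x r. norm (F y) \<le> M \<Longrightarrow> norm (partial F j x) \<le> C * M / r"
    and p: "p \<in> sphere 0 1" and \<delta>: "\<delta> > 0" and C: "C > 0"
    and H: "left_clifford_holomorphic_on H U" "\<And>x. x \<in> sphere 0 1 \<inter> U \<Longrightarrow> H x = 0"
    and U: "cball p (\<rho> + real k * \<delta>) \<subseteq> U"
    and M: "\<And>y. y \<in> cball p (\<rho> + real k * \<delta>) \<Longrightarrow> norm (H y) \<le> M" and v: "norm v \<le> \<rho>"
  shows "norm (H (p + v)) \<le> M * (C / \<delta>) ^ k * (real CARD('n) * norm v) ^ k / fact k"
  using H U M v
proof (induction k arbitrary: H M v)
  case 0
  have "p + v \<in> cball p (\<rho> + real 0 * \<delta>)" using 0(5) by (simp add: dist_norm)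
  from 0(4)[OF this] show ?case by simp
next
  case (Suc k)
  let ?n = "real CARD('n)"
  define B where "B = (C * M / \<delta>) * (C / \<delta>) ^ k"
  have \<rho>: "\<rho> \<ge> 0" using Suc.prems(5) norm_ge_zero[of v] by linarith
  have sub: "cball y \<delta> \<subseteq> cball p (\<rho> + real (Suc k) * \<delta>)" if "y \<in> cball p (\<rho> + real k * \<delta>)" for y
    using that by (intro cball_subset_cball_iff[THEN iffD2]) (simp add: dist_commute algebra_simps)
  have sub': "cball p (\<rho> + real k * \<delta>) \<subseteq> U"
    using Suc.prems(3) \<delta> by (force simp: algebra_simps)
  have M0: "M \<ge> 0"
    using Suc.prems(4)[of p] \<rho> \<delta> by (auto intro: order_trans[OF norm_ge_zero])
  have dj: "norm (partial H j (p + u)) \<le> B * (?n * norm u) ^ k / fact k" if "norm u \<le> \<rho>" for u j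
    unfolding B_def
  proof (rule Suc.IH)
    show "left_clifford_holomorphic_on (partial H j) U"
      by (rule left_clifford_holomorphic_on_partial[OF Suc.prems(1)])
    show "partial H j x = 0" if "x \<in> sphere 0 1 \<inter> U" for x
      by (rule holo_partial_eq_0_on_sphere[OF Suc.prems(1,2) that])
    show "norm (partial H j y) \<le> C * M / \<delta>" if "y \<in> cball p (\<rho> + real k * \<delta>)" for y
      by (rule bound[OF Suc.prems(1) \<delta>]) (use sub[OF that] Suc.prems(3,4) in blast)+
  qed (use that sub' in auto)
  have in_U: "p + t *\<^sub>R v \<in> U" if "0 \<le> t" "t \<le> 1" for t
  proof -
    have "norm (t *\<^sub>R v) \<le> \<rho>" using that Suc.prems(5) mult_left_le_one_le[of "norm v" t] by simp
    then have "p + t *\<^sub>R v \<in> cball p (\<rho> + real k * \<delta>)"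
      using \<delta> by (simp add: dist_norm add_increasing2)
    then show ?thesis using sub' by blast
  qed
  \<comment> \<open>Mean value inequality against the comparison function B (n |v|)^(k+1) t^(k+1) /
    (k+1)!, whose derivative dominates that of \<open>H\<close> along the segment.\<close>
  have "norm (H (p + 1 *\<^sub>R v) - H (p + 0 *\<^sub>R v))
      \<le> B * (?n * norm v) ^ Suc k * 1 ^ Suc k / fact (Suc k) - B * (?n * norm v) ^ Suc k * 0 ^ Suc k / fact (Suc k)"
  proof (rule differentiable_bound_general[where
        f' = "\<lambda>t. \<Sum>j\<in>UNIV. v $ j *\<^sub>R partial H j (p + t *\<^sub>R v)" and
        \<phi>' = "\<lambda>t. B * (?n * norm v) ^ Suc k * t ^ k / fact k"])
    show "continuous_on {0..1} (\<lambda>t. H (p + t *\<^sub>R v))"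
      by (rule continuous_on_compose2[OF holo_continuous[OF Suc.prems(1)]])
        (auto intro!: continuous_intros in_U)
    fix t :: real assume t: "0 < t" "t < 1"
    show "((\<lambda>t. H (p + t *\<^sub>R v)) has_vector_derivative (\<Sum>j\<in>UNIV. v $ j *\<^sub>R partial H j (p + t *\<^sub>R v))) (at t)"
      by (intro has_vector_derivative_line_compose holo_has_derivative[OF Suc.prems(1)] in_U)
        (use t in auto)
    have "((\<lambda>t. B * (?n * norm v) ^ Suc k * t ^ Suc k / fact (Suc k)) has_real_derivative
        B * (?n * norm v) ^ Suc k * (real (Suc k) * t ^ k) / fact (Suc k)) (at t)"
      using DERIV_pow[of "Suc k" t] by (intro DERIV_cdivide DERIV_cmult) simp
    also have "B * (?n * norm v) ^ Suc k * (real (Suc k) * t ^ k) / fact (Suc k)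
        = B * (?n * norm v) ^ Suc k * t ^ k / fact k"
      by (simp add: field_simps del: of_nat_Suc power_Suc)
    finally show "((\<lambda>t. B * (?n * norm v) ^ Suc k * t ^ Suc k / fact (Suc k)) has_vector_derivative
        B * (?n * norm v) ^ Suc k * t ^ k / fact k) (at t)"
      by (simp only: has_real_derivative_iff_has_vector_derivative)
    have tv: "norm (t *\<^sub>R v) \<le> \<rho>"
      using t Suc.prems(5) mult_left_le_one_le[of "norm v" t] by simp
    have "norm (\<Sum>j\<in>UNIV. v $ j *\<^sub>R partial H j (p + t *\<^sub>R v))
        \<le> (\<Sum>j\<in>(UNIV::'n set). norm v * (B * (?n * norm (t *\<^sub>R v)) ^ k / fact k))"
      by (rule sum_norm_le, subst norm_scaleR, rule mult_mono)
        (simp_all only: real_norm_def component_le_norm_cart dj[OF tv] norm_ge_zero)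
    also have "\<dots> = B * (?n * norm v) ^ Suc k * t ^ k / fact k"
      using t by (simp add: power_mult_distrib algebra_simps)
    finally show "norm (\<Sum>j\<in>UNIV. v $ j *\<^sub>R partial H j (p + t *\<^sub>R v))
        \<le> B * (?n * norm v) ^ Suc k * t ^ k / fact k" .
  qed (auto intro!: continuous_intros)
  moreover have "H p = 0" using Suc.prems(2)[of p] p in_U[of 0] by simp
  ultimately show ?case by (simp add: B_def algebra_simps)
qed

text \<open>For each k the estimate is used with k steps that together consume half of
  \<open>R\<close>; the bounds then decay geometrically in k. \<open>c\<close> depends on the
  dimension only, as gluing requires.\<close>

lemma holo_sphere_local_uniqueness:
  "\<exists>c>0. \<forall>(H :: (real, 'n::{finite,linorder}) vec \<Rightarrow> 'n clifford) U p R.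
     left_clifford_holomorphic_on H U \<longrightarrow> p \<in> sphere 0 1 \<longrightarrow> R > 0 \<longrightarrow> cball p R \<subseteq> U \<longrightarrow>
     (\<forall>x\<in>sphere 0 1 \<inter> U. H x = 0) \<longrightarrow> (\<forall>x\<in>ball p (c * R). H x = 0)"
proof -
  obtain C where C: "C > 0" and bound: "\<And>(F :: (real, 'n) vec \<Rightarrow> 'n clifford) U x r M j.
     left_clifford_holomorphic_on F U \<Longrightarrow> r > 0 \<Longrightarrow> cball x r \<subseteq> U \<Longrightarrow>
     \<forall>y\<in>cball x r. norm (F y) \<le> M \<Longrightarrow> norm (partial F j x) \<le> C * M / r"
    using holo_partial_bound by metis
  let ?n = "real CARD('n)"
  \<comment> \<open>The 2 forces \<open>c \<le> 1 / 2\<close>, so that \<open>v\<close> stays in the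
    half ball left after all steps; the other summand forces the ratio 2 C n e |v| / R to be at most
    1 / 2.\<close>
  define c where "c = 1 / (2 + 4 * C * ?n * exp 1)"
  have den: "2 + 4 * C * ?n * exp 1 > 0" using C by (simp add: add_pos_nonneg)
  then have c0: "c > 0" by (simp add: c_def)
  have "c * (2 + 4 * C * ?n * exp 1) = 1" using den by (simp add: c_def)
  then have c1: "2 * c + 4 * C * ?n * exp 1 * c = 1" by (simp add: algebra_simps)
  have pos: "4 * C * ?n * exp 1 * c \<ge> 0" using C c0 by simp
  have "H (p + v) = 0" if H: "left_clifford_holomorphic_on H U" and p: "p \<in> sphere 0 1" and R: "R > 0"
    and U: "cball p R \<subseteq> U" and zero: "\<And>x. x \<in> sphere 0 1 \<inter> U \<Longrightarrow> H x = 0" and v: "norm v < c * R"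
    for H :: "(real, 'n) vec \<Rightarrow> 'n clifford" and U p R v
  proof -
    have "compact (H ` cball p R)"
      using holo_continuous[OF H] U by (intro compact_continuous_image) (auto intro: continuous_on_subset)
    then obtain M where M: "\<And>y. y \<in> cball p R \<Longrightarrow> norm (H y) \<le> M"
      using compact_imp_bounded[of "H ` cball p R"] unfolding bounded_iff by blast
    have M0: "M \<ge> 0" using M[of p] R by (auto intro: order_trans[OF norm_ge_zero])
    have c2: "c \<le> 1 / 2" using c1 pos by linarith
    have "c * R \<le> 1 / 2 * R" using c2 by (rule mult_right_mono) (use R in simp)
    then have vR: "norm v \<le> R / 2" using v by linarith
    have est: "norm (H (p + v)) \<le> M * (1 / 2) ^ k" if k: "k > 0" for k
    proof -
      define \<delta> where "\<delta> = R / (2 * real k)"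
      have \<delta>: "\<delta> > 0" using R k by (simp add: \<delta>_def)
      have R2: "R / 2 + real k * \<delta> = R" using k by (simp add: \<delta>_def)
      have "norm (H (p + v)) \<le> M * (C / \<delta>) ^ k * (?n * norm v) ^ k / fact k"
        by (rule holo_vanishing_estimate[where U = U and \<rho> = "R / 2"])
          (use bound p \<delta> C H zero U M vR in \<open>auto simp: R2\<close>)
      also have "\<dots> = M * (2 * C * ?n * norm v / R) ^ k * (real k ^ k / fact k)"
      proof -
        have "C / \<delta> * (?n * norm v) = 2 * C * ?n * norm v / R * real k"
          unfolding \<delta>_def by simp
        then have "(C / \<delta>) ^ k * (?n * norm v) ^ k = (2 * C * ?n * norm v / R) ^ k * real k ^ k"
          by (simp only: flip: power_mult_distrib)
        then show ?thesis by (simp only: mult.assoc times_divide_eq_right)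
      qed
      also have "\<dots> \<le> M * (2 * C * ?n * norm v / R) ^ k * exp 1 ^ k"
        using power_self_le_exp_fact[of k] M0 C R
        by (intro mult_left_mono) (auto simp: field_simps)
      also have "\<dots> = M * (2 * C * ?n * exp 1 * (norm v / R)) ^ k"
        by (simp add: power_mult_distrib power_divide)
      also have "\<dots> \<le> M * (1 / 2) ^ k"
      proof (intro mult_left_mono power_mono)
        have "norm v / R \<le> c" using v R by (simp add: field_simps)
        then have "2 * C * ?n * exp 1 * (norm v / R) \<le> 2 * C * ?n * exp 1 * c"
          using C by (intro mult_left_mono) auto
        also have "\<dots> \<le> 1 / 2" using c1 c0 by linarith
        finally show "2 * C * ?n * exp 1 * (norm v / R) \<le> 1 / 2" .
      qed (use C R M0 in auto)
      finally show ?thesis .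
    qed
    have "(\<lambda>k. M * (1 / 2) ^ k) \<longlonglongrightarrow> M * 0"
      by (intro tendsto_intros) simp
    then have "norm (H (p + v)) \<le> M * 0"
      by (rule LIMSEQ_le_const) (use est in \<open>auto intro!: exI[of _ 1]\<close>)
    then show ?thesis by simp
  qed
  note main = this
  have "H x = 0" if "left_clifford_holomorphic_on H U" "p \<in> sphere 0 1" "R > 0" "cball p R \<subseteq> U"
      "\<forall>x\<in>sphere 0 1 \<inter> U. H x = 0" "x \<in> ball p (c * R)"
    for H :: "(real, 'n) vec \<Rightarrow> 'n clifford" and U p R x
    using main[OF that(1-4), of "x - p"] that by (simp add: dist_norm norm_minus_commute)
  then show ?thesis using c0 by blast
qed

section \<open>Power series in several variables\<close>

text \<open>A Weierstrass test for the derivatives: the bound by \<open>B n * norm h\<close>,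
  uniform on \<open>S\<close>, makes the tails small uniformly in the point.\<close>

lemma has_derivative_suminf:
  fixes f :: "nat \<Rightarrow> 'a::real_normed_vector \<Rightarrow> 'b::banach"
  assumes S: "open S" "convex S"
    and deriv: "\<And>n x. x \<in> S \<Longrightarrow> (f n has_derivative f' n x) (at x)"
    and bound: "\<And>n x h. x \<in> S \<Longrightarrow> norm (f' n x h) \<le> B n * norm h"
    and B: "summable B" and conv: "\<And>x. x \<in> S \<Longrightarrow> summable (\<lambda>n. f n x)" and x: "x \<in> S"
  shows "((\<lambda>x. \<Sum>n. f n x) has_derivative (\<lambda>h. \<Sum>n. f' n x h)) (at x)"
proof -
  have sf': "summable (\<lambda>n. norm (f' n y h))" if "y \<in> S" for y h
    by (rule summable_comparison_test'[OF summable_mult2[OF B, of "norm h"], of 0])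
      (use bound that in auto)
  have "\<exists>g. \<forall>y\<in>S. (\<lambda>n. f n y) sums g y \<and> (g has_derivative (\<lambda>h. \<Sum>n. f' n y h)) (at y within S)"
  proof (rule has_derivative_series[where f = f and f' = f' and x = x and l = "\<Sum>n. f n x"])
    fix e :: real assume "e > 0"
    from suminf_exist_split[OF this B] obtain N where N: "\<And>n. n \<ge> N \<Longrightarrow> norm (\<Sum>i. B (i + n)) < e"
      by blast
    show "\<forall>\<^sub>F n in sequentially. \<forall>y\<in>S. \<forall>h. norm ((\<Sum>i<n. f' i y h) - (\<Sum>n. f' n y h)) \<le> e * norm h"
    proof (rule eventually_sequentiallyI[of N], intro ballI allI)
      fix n y h assume n: "N \<le> n" and y: "y \<in> S"
      have "norm ((\<Sum>i<n. f' i y h) - (\<Sum>n. f' n y h)) = norm (\<Sum>i. f' (i + n) y h)"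
        using suminf_minus_initial_segment[OF summable_norm_cancel[OF sf'[OF y, of h]], of n]
        by (simp add: norm_minus_commute)
      also have "\<dots> \<le> (\<Sum>i. norm (f' (i + n) y h))"
        by (rule summable_norm) (use summable_ignore_initial_segment[OF sf'[OF y]] in simp)
      also have "\<dots> \<le> (\<Sum>i. B (i + n) * norm h)"
        by (intro suminf_le bound y summable_mult2)
          (use summable_ignore_initial_segment[OF sf'[OF y]] summable_ignore_initial_segment[OF B] in auto)
      also have "\<dots> = (\<Sum>i. B (i + n)) * norm h"
        by (rule suminf_mult2[symmetric]) (use summable_ignore_initial_segment[OF B] in simp)
      also have "\<dots> \<le> e * norm h" using N[OF n] by (intro mult_right_mono) auto
      finally show "norm ((\<Sum>i<n. f' i y h) - (\<Sum>n. f' n y h)) \<le> e * norm h" .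
    qed
  qed (use S x summable_sums[OF conv[OF x]] deriv in \<open>auto intro: has_derivative_at_withinI\<close>)
  then obtain g where g: "\<And>y. y \<in> S \<Longrightarrow> (\<lambda>n. f n y) sums g y"
    "\<And>y. y \<in> S \<Longrightarrow> (g has_derivative (\<lambda>h. \<Sum>n. f' n y h)) (at y within S)" by blast
  have "(g has_derivative (\<lambda>h. \<Sum>n. f' n x h)) (at x)" using g(2)[OF x] at_within_open[OF x S(1)] by simp
  then show ?thesis
    by (rule has_derivative_transform_within_open[OF _ S(1) x]) (use sums_unique[OF g(1)] in simp)
qed

section \<open>Monomials and multi-indices\<close>

definition mpow :: "('n \<Rightarrow> nat) \<Rightarrow> real ^ 'n \<Rightarrow> real" where
  "mpow \<alpha> y = (\<Prod>i\<in>UNIV. (y $ i) ^ \<alpha> i)"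

definition deg :: "('n::finite \<Rightarrow> nat) \<Rightarrow> nat" where
  "deg \<alpha> = (\<Sum>i\<in>UNIV. \<alpha> i)"

definition up :: "'n \<Rightarrow> ('n \<Rightarrow> nat) \<Rightarrow> 'n \<Rightarrow> nat" where
  "up j \<alpha> = \<alpha>(j := Suc (\<alpha> j))"

text \<open>Truncated subtraction leaves \<open>\<alpha>\<close> unchanged if
  \<open>\<alpha> j = 0\<close>. Where \<open>down\<close> is used later, this case is killed by a
  factor \<open>real (\<alpha> j)\<close> or excluded by a case distinction.\<close>

definition down :: "'n \<Rightarrow> ('n \<Rightarrow> nat) \<Rightarrow> 'n \<Rightarrow> nat" where
  "down j \<alpha> = \<alpha>(j := \<alpha> j - 1)"

lemma down_up [simp]: "down j (up j \<alpha>) = \<alpha>"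
  by (simp add: up_def down_def)

lemma up_down: "\<alpha> j \<noteq> 0 \<Longrightarrow> up j (down j \<alpha>) = \<alpha>"
  by (auto simp: up_def down_def fun_eq_iff)

lemma up_nth [simp]: "up j \<alpha> j = Suc (\<alpha> j)"
  by (simp add: up_def)

lemma inj_up: "inj (up j)"
  by (metis down_up injI)

lemma range_up: "\<alpha> \<in> range (up j) \<longleftrightarrow> \<alpha> j \<noteq> 0"
  by (metis Zero_not_Suc rangeE rangeI up_down up_nth)

lemma deg_up: "deg (up j \<alpha>) = Suc (deg \<alpha>)"
proof -
  have "deg (up j \<alpha>) = Suc (\<alpha> j) + (\<Sum>i\<in>UNIV - {j}. \<alpha> i)"
    unfolding deg_def by (subst sum.remove[of UNIV j]) (auto simp: up_def intro!: sum.cong)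
  also have "\<dots> = Suc (deg \<alpha>)" unfolding deg_def by (subst sum.remove[of UNIV j]) auto
  finally show ?thesis .
qed

lemma mpow_up: "mpow (up j \<alpha>) y = y $ j * mpow \<alpha> y"
proof -
  have "mpow (up j \<alpha>) y = y $ j ^ Suc (\<alpha> j) * (\<Prod>i\<in>UNIV - {j}. (y $ i) ^ \<alpha> i)"
    unfolding mpow_def by (subst prod.remove[of UNIV j]) (auto simp: up_def intro!: prod.cong)
  also have "\<dots> = y $ j * mpow \<alpha> y" unfolding mpow_def using prod.remove[of UNIV j "\<lambda>i. (y $ i) ^ \<alpha> i"] by simp
  finally show ?thesis .
qed

lemma abs_mpow_le:
  assumes "y \<in> cube s"
  shows "\<bar>mpow \<alpha> y\<bar> \<le> s ^ deg \<alpha>"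
proof -
  have "\<bar>mpow \<alpha> y\<bar> = (\<Prod>i\<in>UNIV. \<bar>y $ i\<bar> ^ \<alpha> i)" by (simp add: mpow_def abs_prod power_abs)
  also have "\<dots> \<le> (\<Prod>i\<in>UNIV. s ^ \<alpha> i)"
    using assms by (intro prod_mono) (auto simp: mem_cube intro!: power_mono)
  also have "\<dots> = s ^ deg \<alpha>" by (simp add: deg_def power_sum)
  finally show ?thesis .
qed

lemma mpow_has_derivative:
  "(mpow \<alpha> has_derivative (\<lambda>h. \<Sum>i\<in>UNIV. h $ i * (real (\<alpha> i) * mpow (down i \<alpha>) y))) (at y)"
proof -
  have "((\<lambda>y::real ^ 'a. \<Prod>i\<in>UNIV. (y $ i) ^ \<alpha> i) has_derivative
      (\<lambda>h. \<Sum>i\<in>UNIV. (real (\<alpha> i) * h $ i * y $ i ^ (\<alpha> i - 1)) * (\<Prod>j\<in>UNIV - {i}. (y $ j) ^ \<alpha> j))) (at y)"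
    by (rule has_derivative_prod)
      (auto intro!: derivative_eq_intros bounded_linear_imp_has_derivative simp: fun_eq_iff)
  moreover have "mpow (down i \<alpha>) y = y $ i ^ (\<alpha> i - 1) * (\<Prod>j\<in>UNIV - {i}. (y $ j) ^ \<alpha> j)" for i
    unfolding mpow_def by (subst prod.remove[of UNIV i]) (auto simp: down_def intro!: prod.cong)
  ultimately show ?thesis unfolding mpow_def[abs_def]
    by (elim has_derivative_eq_rhs) (auto simp: mpow_def fun_eq_iff mult_ac)
qed

text \<open>s^m - t^m is s - t times a sum of m products s^i t^(m-1-i), each at least t^(m-1). This
  is where the loss 1 / (s - t) per derivative originates.\<close>

lemma derivative_weight_le:
  fixes s :: real
  assumes "0 \<le> t" "t < s"
  shows "real m * t ^ (m - 1) \<le> s ^ m / (s - t)"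
proof (cases m)
  case (Suc k)
  have "real (Suc k) * t ^ k = (\<Sum>i<Suc k. t ^ k)" by simp
  also have "\<dots> \<le> (\<Sum>i<Suc k. s ^ i * t ^ (k - i))"
  proof (rule sum_mono)
    fix i assume "i \<in> {..<Suc k}"
    then have "t ^ k = t ^ i * t ^ (k - i)" by (simp flip: power_add)
    also have "\<dots> \<le> s ^ i * t ^ (k - i)"
      using assms by (intro mult_right_mono power_mono) auto
    finally show "t ^ k \<le> s ^ i * t ^ (k - i)" .
  qed
  finally have "(s - t) * (real (Suc k) * t ^ k) \<le> (s - t) * (\<Sum>i<Suc k. s ^ i * t ^ (k - i))"
    using assms by (intro mult_left_mono) auto
  also have "\<dots> = s ^ Suc k - t ^ Suc k"
    by (subst diff_power_eq_sum) (simp add: mult.commute)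
  also have "\<dots> \<le> s ^ Suc k" using assms by simp
  finally show ?thesis using assms Suc by (simp add: field_simps)
qed (use assms in auto)

lemma real_deg_mpow_down_le:
  fixes y :: "real ^ 'n"
  assumes "y \<in> cube t" "0 \<le> t" "t < s"
  shows "real (\<alpha> i) * \<bar>mpow (down i \<alpha>) y\<bar> \<le> s ^ deg \<alpha> / (s - t)"
proof (cases "\<alpha> i = 0")
  case False
  then have deg: "deg \<alpha> = Suc (deg (down i \<alpha>))" using deg_up[of i "down i \<alpha>"] by (simp add: up_down)
  have "\<alpha> i \<le> deg \<alpha>" unfolding deg_def by (rule member_le_sum) auto
  then have "real (\<alpha> i) * \<bar>mpow (down i \<alpha>) y\<bar> \<le> real (deg \<alpha>) * t ^ deg (down i \<alpha>)"
    by (intro mult_mono abs_mpow_le assms) auto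
  also have "\<dots> \<le> s ^ deg \<alpha> / (s - t)" using derivative_weight_le[OF assms(2,3), of "deg \<alpha>"] by (simp add: deg)
  finally show ?thesis .
qed (use assms in auto)

text \<open>Turns unordered sums over multi-indices into series over \<open>nat\<close>, to which
  \<open>has_derivative_suminf\<close> applies.\<close>

lemma multiindex_enumeration:
  obtains b :: "nat \<Rightarrow> ('n::finite \<Rightarrow> nat)" where "bij b"
proof -
  have "inj (\<lambda>k. (\<lambda>_. k) :: 'n \<Rightarrow> nat)" by (rule injI) (metis)
  then have inf: "infinite (UNIV :: ('n \<Rightarrow> nat) set)"
    by (meson finite_subset infinite_UNIV_nat range_inj_infinite subset_UNIV)
  obtain e :: "('n \<Rightarrow> nat) \<Rightarrow> nat" where "bij e"
    using countableE_infinite[OF countableI_type inf] by blast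
  then show ?thesis using that bij_imp_bij_inv by blast
qed

text \<open>A weighted l^1 norm of the coefficients, bounded through finite partial sums so that
  bounds transfer by termwise comparison. The weight \<open>s ^ deg \<alpha>\<close> is the bound of
  the monomial on the cube, hence \<open>M\<close> also bounds \<open>h\<close> there.\<close>

locale multi_power_series =
  fixes p :: "real ^ 'n" and s M :: real and c :: "('n \<Rightarrow> nat) \<Rightarrow> 'b::banach" and h :: "real ^ 'n \<Rightarrow> 'b"
  assumes coeff_bound: "\<And>A. finite A \<Longrightarrow> (\<Sum>\<alpha>\<in>A. norm (c \<alpha>) * s ^ deg \<alpha>) \<le> M"
    and expansion: "\<And>x. x - p \<in> cube s \<Longrightarrow> ((\<lambda>\<alpha>. mpow \<alpha> (x - p) *\<^sub>R c \<alpha>) has_sum h x) UNIV"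
    and radius_pos: "s > 0"
begin

lemma norm_le: "x - p \<in> cube s \<Longrightarrow> norm (h x) \<le> M"
proof -
  assume x: "x - p \<in> cube s"
  show ?thesis
  proof (rule Lim_norm_ubound[OF _ expansion[OF x, unfolded has_sum_def]])
    show "\<forall>\<^sub>F A in finite_subsets_at_top UNIV. norm (\<Sum>\<alpha>\<in>A. mpow \<alpha> (x - p) *\<^sub>R c \<alpha>) \<le> M"
    proof (rule eventually_finite_subsets_at_top_weakI)
      fix A :: "('n \<Rightarrow> nat) set" assume A: "finite A"
      have "norm (\<Sum>\<alpha>\<in>A. mpow \<alpha> (x - p) *\<^sub>R c \<alpha>) \<le> (\<Sum>\<alpha>\<in>A. norm (c \<alpha>) * s ^ deg \<alpha>)"
        by (rule sum_norm_le) (simp add: mult.commute[of "norm _"] mult_right_mono abs_mpow_le[OF x])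
      then show "norm (\<Sum>\<alpha>\<in>A. mpow \<alpha> (x - p) *\<^sub>R c \<alpha>) \<le> M" using coeff_bound[OF A] by linarith
    qed
  qed simp
qed

text \<open>Strict inequality in finitely many coordinates leaves room for a \<open>t < s\<close>
  whose open box contains \<open>x\<close>; there the differentiated series is dominated by a
  multiple of the l^1 series. \<open>D\<close> is returned as an unordered sum so that
  \<open>analytic_bound_partial\<close> can read off its coefficients.\<close>

lemma termwise_derivative:
  assumes x: "\<And>i. \<bar>x $ i - p $ i\<bar> < s"
  obtains D where "\<And>i. ((\<lambda>\<alpha>. (real (\<alpha> i) * mpow (down i \<alpha>) (x - p)) *\<^sub>R c \<alpha>) has_sum D i) UNIV"
    and "(h has_derivative (\<lambda>v. \<Sum>i\<in>UNIV. v $ i *\<^sub>R D i)) (at x)"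
proof -
  obtain b :: "nat \<Rightarrow> ('n \<Rightarrow> nat)" where b: "bij b" by (rule multiindex_enumeration)
  define m where "m = Max (range (\<lambda>i. \<bar>x $ i - p $ i\<bar>))"
  have m: "\<bar>x $ i - p $ i\<bar> \<le> m" for i unfolding m_def by (rule Max_ge) auto
  have "m < s" unfolding m_def using x by (subst Max_less_iff) auto
  then obtain t where t: "m < t" "t < s" using dense by blast
  \<comment> \<open>\<open>undefined\<close> serves merely as some index, to see that
    \<open>m\<close> is nonnegative.\<close>
  have t0: "t > 0" using m[of undefined] t by linarith
  define S where "S = box (p - (\<chi> i. t)) (p + (\<chi> i. t))"
  have S: "y \<in> S \<longleftrightarrow> (\<forall>i. \<bar>y $ i - p $ i\<bar> < t)" for y
    by (simp add: S_def mem_box_cart abs_less_iff algebra_simps) (metis add.commute less_diff_eq)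
  have S': "open S" "convex S" "x \<in> S"
    using m t by (auto simp: S intro: le_less_trans) (auto simp: S_def open_box convex_box)
  have Sc: "y - p \<in> cube t" "y - p \<in> cube s" if "y \<in> S" for y
    using that t by (auto simp: S mem_cube intro: less_imp_le less_trans)
  define w where "w n = norm (c (b n)) * s ^ deg (b n)" for n
  have w0: "w n \<ge> 0" for n using radius_pos by (simp add: w_def)
  have w: "summable w"
  proof (rule bounded_imp_summable[OF w0])
    fix N
    have "sum w {..N} = (\<Sum>\<alpha>\<in>b ` {..N}. norm (c \<alpha>) * s ^ deg \<alpha>)"
      using b by (subst sum.reindex) (auto simp: w_def bij_def inj_on_def)
    then show "sum w {..N} \<le> M" using coeff_bound by simp
  qed
  define f where "f n y = mpow (b n) (y - p) *\<^sub>R c (b n)" for n y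
  define f' where "f' n y v = (\<Sum>i\<in>UNIV. v $ i * (real (b n i) * mpow (down i (b n)) (y - p))) *\<^sub>R c (b n)" for n y v
  define K where "K = real CARD('n) / (s - t)"
  have coef: "norm ((real (b n i) * mpow (down i (b n)) (y - p)) *\<^sub>R c (b n)) \<le> (1 / (s - t)) * w n"
    if "y \<in> S" for n y i
  proof -
    have "norm ((real (b n i) * mpow (down i (b n)) (y - p)) *\<^sub>R c (b n))
        = (real (b n i) * \<bar>mpow (down i (b n)) (y - p)\<bar>) * norm (c (b n))" by (simp add: abs_mult)
    also have "\<dots> \<le> (s ^ deg (b n) / (s - t)) * norm (c (b n))"
      by (intro mult_right_mono real_deg_mpow_down_le Sc that) (use t t0 in auto)
    finally show ?thesis by (simp add: w_def mult.commute)
  qed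
  have sumf: "summable (\<lambda>n. f n y)" if "y \<in> S" for y
  proof (rule summable_comparison_test'[OF w, of 0])
    fix n
    show "norm (f n y) \<le> w n"
      using abs_mpow_le[OF Sc(2)[OF that], of "b n"]
      by (simp add: f_def w_def mult.commute[of "norm _"] mult_right_mono)
  qed
  have deriv: "((\<lambda>y. \<Sum>n. f n y) has_derivative (\<lambda>v. \<Sum>n. f' n x v)) (at x)"
  proof (rule has_derivative_suminf[OF S'(1,2) _ _ summable_mult[OF w, of K] sumf S'(3)])
    fix n y assume "y \<in> S"
    have "((\<lambda>y. mpow (b n) (y - p)) has_derivative
        (\<lambda>v. \<Sum>i\<in>UNIV. v $ i * (real (b n i) * mpow (down i (b n)) (y - p)))) (at y)"
      by (rule has_derivative_compose[where f = "\<lambda>y. y - p" and g = "mpow (b n)", OF _ mpow_has_derivative])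
        (auto intro!: derivative_eq_intros)
    then show "(f n has_derivative f' n y) (at y)"
      unfolding f_def f'_def by (rule has_derivative_scaleR_left)
  next
    fix n y and v :: "real ^ 'n" assume y: "y \<in> S"
    have "norm (f' n y v) = norm (\<Sum>i\<in>UNIV. v $ i *\<^sub>R ((real (b n i) * mpow (down i (b n)) (y - p)) *\<^sub>R c (b n)))"
      by (simp add: f'_def scaleR_sum_left)
    also have "\<dots> \<le> (\<Sum>i\<in>(UNIV::'n set). norm v * ((1 / (s - t)) * w n))"
      by (rule sum_norm_le, subst norm_scaleR, rule mult_mono)
        (simp_all only: real_norm_def component_le_norm_cart coef[OF y] norm_ge_zero)
    also have "\<dots> = K * w n * norm v" by (simp add: K_def)
    finally show "norm (f' n y v) \<le> K * w n * norm v" .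
  qed
  have hf: "h y = (\<Sum>n. f n y)" if "y \<in> S" for y
  proof -
    have "((\<lambda>n. f n y) has_sum h y) UNIV"
      unfolding f_def
      using has_sum_reindex_bij_betw[OF b, of "\<lambda>\<alpha>. mpow \<alpha> (y - p) *\<^sub>R c \<alpha>"] expansion[OF Sc(2)[OF that]]
      by simp
    then show ?thesis using has_sum_imp_sums sums_unique by blast
  qed
  define D where "D i = (\<Sum>n. (real (b n i) * mpow (down i (b n)) (x - p)) *\<^sub>R c (b n))" for i
  have absD: "summable (\<lambda>n. norm ((real (b n i) * mpow (down i (b n)) (x - p)) *\<^sub>R c (b n)))" for i
    by (rule summable_comparison_test'[OF summable_mult[OF w, of "1 / (s - t)"], of 0])
      (use coef[OF S'(3)] in simp)
  have D: "(\<lambda>n. (real (b n i) * mpow (down i (b n)) (x - p)) *\<^sub>R c (b n)) sums D i" for i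
    unfolding D_def by (rule summable_sums[OF summable_norm_cancel[OF absD]])
  show ?thesis
  proof (rule that[of D])
    fix i
    show "((\<lambda>\<alpha>. (real (\<alpha> i) * mpow (down i \<alpha>) (x - p)) *\<^sub>R c \<alpha>) has_sum D i) UNIV"
      by (rule has_sum_reindex_bij_betw[OF b, THEN iffD1]) (rule norm_summable_imp_has_sum[OF absD D])
  next
    have "(\<Sum>n. f' n x v) = (\<Sum>i\<in>UNIV. v $ i *\<^sub>R D i)" for v
    proof -
      have "(\<lambda>n. \<Sum>i\<in>UNIV. v $ i *\<^sub>R ((real (b n i) * mpow (down i (b n)) (x - p)) *\<^sub>R c (b n)))
          sums (\<Sum>i\<in>UNIV. v $ i *\<^sub>R D i)"
        by (intro sums_sum sums_scaleR_right D)
      then have "(\<lambda>n. f' n x v) sums (\<Sum>i\<in>UNIV. v $ i *\<^sub>R D i)"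
        by (simp add: f'_def scaleR_sum_left)
      then show ?thesis by (rule sums_unique[symmetric])
    qed
    then have "((\<lambda>y. \<Sum>n. f n y) has_derivative (\<lambda>v. \<Sum>i\<in>UNIV. v $ i *\<^sub>R D i)) (at x)"
      using deriv by simp
    then show "(h has_derivative (\<lambda>v. \<Sum>i\<in>UNIV. v $ i *\<^sub>R D i)) (at x)"
      by (rule has_derivative_transform_within_open[OF _ S'(1,3)]) (simp add: hf)
  qed
qed

end

text \<open>Hides the coefficients, so that the effect of an operator is recorded by radius and
  bound alone.\<close>

definition analytic_bound :: "real ^ 'n \<Rightarrow> real \<Rightarrow> real \<Rightarrow> (real ^ 'n \<Rightarrow> 'b::banach) \<Rightarrow> bool" where
  "analytic_bound p s M h \<longleftrightarrow> (\<exists>c. multi_power_series p s M c h)"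

lemma analytic_bound_norm_le:
  "analytic_bound p s M h \<Longrightarrow> x - p \<in> cube s \<Longrightarrow> norm (h x) \<le> M"
  unfolding analytic_bound_def using multi_power_series.norm_le by blast

lemma analytic_bound_differentiable:
  assumes "analytic_bound p s M h" "\<And>i. \<bar>x $ i - p $ i\<bar> < s"
  shows "h differentiable (at x)"
proof -
  obtain c where "multi_power_series p s M c h" using assms by (auto simp: analytic_bound_def)
  then obtain D where "(h has_derivative (\<lambda>v. \<Sum>i\<in>UNIV. v $ i *\<^sub>R D i)) (at x)"
    using multi_power_series.termwise_derivative[OF _ assms(2)] by blast
  then show ?thesis by (auto simp: differentiable_def)
qed

lemma analytic_bound_antimono:
  assumes "analytic_bound p s M h" "0 < s'" "s' \<le> s" "M \<le> M'"
  shows "analytic_bound p s' M' h"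
proof -
  obtain c where c: "multi_power_series p s M c h" using assms by (auto simp: analytic_bound_def)
  interpret multi_power_series p s M c h by (rule c)
  have "multi_power_series p s' M' c h"
  proof
    fix A :: "('a \<Rightarrow> nat) set" assume "finite A"
    have "(\<Sum>\<alpha>\<in>A. norm (c \<alpha>) * s' ^ deg \<alpha>) \<le> (\<Sum>\<alpha>\<in>A. norm (c \<alpha>) * s ^ deg \<alpha>)"
      using assms by (intro sum_mono mult_left_mono power_mono) auto
    then show "(\<Sum>\<alpha>\<in>A. norm (c \<alpha>) * s' ^ deg \<alpha>) \<le> M'" using coeff_bound[OF \<open>finite A\<close>] assms by linarith
  qed (use assms expansion cube_mono[of s' s] in auto)
  then show ?thesis by (auto simp: analytic_bound_def)
qed

lemma analytic_bound_add:
  assumes "analytic_bound p s M1 h1" "analytic_bound p s M2 h2"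
  shows "analytic_bound p s (M1 + M2) (\<lambda>x. h1 x + h2 x)"
proof -
  obtain c1 c2 where c: "multi_power_series p s M1 c1 h1" "multi_power_series p s M2 c2 h2"
    using assms by (auto simp: analytic_bound_def)
  interpret P1: multi_power_series p s M1 c1 h1 by (rule c)
  interpret P2: multi_power_series p s M2 c2 h2 by (rule c)
  have "multi_power_series p s (M1 + M2) (\<lambda>\<alpha>. c1 \<alpha> + c2 \<alpha>) (\<lambda>x. h1 x + h2 x)"
  proof
    fix A :: "('a \<Rightarrow> nat) set" assume "finite A"
    have "(\<Sum>\<alpha>\<in>A. norm (c1 \<alpha> + c2 \<alpha>) * s ^ deg \<alpha>)
        \<le> (\<Sum>\<alpha>\<in>A. norm (c1 \<alpha>) * s ^ deg \<alpha> + norm (c2 \<alpha>) * s ^ deg \<alpha>)"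
      using P1.radius_pos
      by (intro sum_mono) (simp add: norm_triangle_ineq mult_right_mono flip: distrib_right)
    then show "(\<Sum>\<alpha>\<in>A. norm (c1 \<alpha> + c2 \<alpha>) * s ^ deg \<alpha>) \<le> M1 + M2"
      using P1.coeff_bound[OF \<open>finite A\<close>] P2.coeff_bound[OF \<open>finite A\<close>] by (simp add: sum.distrib)
  next
    fix x assume "x - p \<in> cube s"
    from has_sum_add[OF P1.expansion[OF this] P2.expansion[OF this]]
    show "((\<lambda>\<alpha>. mpow \<alpha> (x - p) *\<^sub>R (c1 \<alpha> + c2 \<alpha>)) has_sum h1 x + h2 x) UNIV"
      by (simp add: scaleR_add_right)
  qed (rule P1.radius_pos)
  then show ?thesis by (auto simp: analytic_bound_def)
qed

lemma analytic_bound_bounded_linear: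
  assumes "analytic_bound p s M h" "bounded_linear f" "\<And>y. norm (f y) \<le> a * norm y" "a \<ge> 0"
  shows "analytic_bound p s (a * M) (\<lambda>x. f (h x))"
proof -
  obtain c where c: "multi_power_series p s M c h" using assms by (auto simp: analytic_bound_def)
  interpret multi_power_series p s M c h by (rule c)
  have "multi_power_series p s (a * M) (\<lambda>\<alpha>. f (c \<alpha>)) (\<lambda>x. f (h x))"
  proof
    fix A :: "('a \<Rightarrow> nat) set" assume "finite A"
    have "(\<Sum>\<alpha>\<in>A. norm (f (c \<alpha>)) * s ^ deg \<alpha>) \<le> (\<Sum>\<alpha>\<in>A. a * (norm (c \<alpha>) * s ^ deg \<alpha>))"
      using radius_pos assms(3) by (intro sum_mono) (simp add: mult_right_mono flip: mult.assoc)
    also have "\<dots> \<le> a * M"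
      unfolding sum_distrib_left[symmetric] by (intro mult_left_mono coeff_bound \<open>finite A\<close> assms)
    finally show "(\<Sum>\<alpha>\<in>A. norm (f (c \<alpha>)) * s ^ deg \<alpha>) \<le> a * M" .
  next
    fix x assume "x - p \<in> cube s"
    from has_sum_bounded_linear[OF assms(2) expansion[OF this]]
    show "((\<lambda>\<alpha>. mpow \<alpha> (x - p) *\<^sub>R f (c \<alpha>)) has_sum f (h x)) UNIV"
      by (simp add: o_def linear_scale[OF bounded_linear.linear[OF assms(2)]])
  qed (rule radius_pos)
  then show ?thesis by (auto simp: analytic_bound_def)
qed

lemma analytic_bound_0: "s > 0 \<Longrightarrow> analytic_bound p s 0 (\<lambda>x. 0)"
  unfolding analytic_bound_def
  by (intro exI[of _ "\<lambda>_. 0"]) (unfold_locales, auto)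

lemma analytic_bound_sum:
  assumes "finite I" "s > 0" "\<And>i. i \<in> I \<Longrightarrow> analytic_bound p s M (h i)"
  shows "analytic_bound p s (real (card I) * M) (\<lambda>x. \<Sum>i\<in>I. h i x)"
  using assms(1,3)
proof (induction I)
  case empty
  then show ?case using analytic_bound_0[OF assms(2)] by simp
next
  case (insert i I)
  have "analytic_bound p s (M + real (card I) * M) (\<lambda>x. h i x + (\<Sum>i\<in>I. h i x))"
    using insert by (intro analytic_bound_add) auto
  then show ?case using insert by (simp add: algebra_simps)
qed

section \<open>Coordinate multiplication and differentiation as coefficient shifts\<close>

lemma sum_vimage_up:
  assumes "finite A" "\<And>\<alpha>. \<alpha> j = 0 \<Longrightarrow> f \<alpha> = (0::real)"
  shows "sum f A = (\<Sum>\<alpha>\<in>up j -` A. f (up j \<alpha>))"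
proof -
  have "(\<Sum>\<alpha>\<in>up j -` A. f (up j \<alpha>)) = sum f (up j ` (up j -` A))"
    by (subst sum.reindex) (auto intro: inj_on_subset[OF inj_up])
  also have "\<dots> = sum f A"
  proof (rule sum.mono_neutral_left)
    show "\<forall>\<alpha>\<in>A - up j ` (up j -` A). f \<alpha> = 0"
    proof
      fix \<alpha> assume "\<alpha> \<in> A - up j ` (up j -` A)"
      then have "\<alpha> \<notin> range (up j)" by auto
      then show "f \<alpha> = 0" using assms(2) range_up[of \<alpha> j] by simp
    qed
  qed (use assms in auto)
  finally show ?thesis ..
qed

lemma has_sum_up:
  assumes "\<And>\<alpha>. \<alpha> j = 0 \<Longrightarrow> f \<alpha> = 0"
  shows "(f has_sum l) UNIV \<longleftrightarrow> ((\<lambda>\<alpha>. f (up j \<alpha>)) has_sum l) UNIV"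
proof -
  have "(f has_sum l) UNIV \<longleftrightarrow> (f has_sum l) (range (up j))"
    by (rule has_sum_cong_neutral) (use assms range_up[of _ j] in auto)
  also have "\<dots> \<longleftrightarrow> ((\<lambda>\<alpha>. f (up j \<alpha>)) has_sum l) UNIV"
    using has_sum_reindex[OF inj_up, of f j l] by (simp add: o_def)
  finally show ?thesis .
qed

text \<open>Each coefficient moves up one degree, which costs one factor \<open>s\<close> in the
  weight.\<close>

lemma analytic_bound_shifted_coordinate:
  assumes "analytic_bound p s M h"
  shows "analytic_bound p s (s * M) (\<lambda>x. (x $ i - p $ i) *\<^sub>R h x)"
proof -
  obtain c where c: "multi_power_series p s M c h" using assms by (auto simp: analytic_bound_def)
  interpret multi_power_series p s M c h by (rule c)
  let ?c = "\<lambda>\<alpha>. if \<alpha> i = 0 then 0 else c (down i \<alpha>)"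
  have "multi_power_series p s (s * M) ?c (\<lambda>x. (x $ i - p $ i) *\<^sub>R h x)"
  proof
    fix A :: "('a \<Rightarrow> nat) set" assume A: "finite A"
    have "(\<Sum>\<alpha>\<in>A. norm (?c \<alpha>) * s ^ deg \<alpha>) = (\<Sum>\<alpha>\<in>up i -` A. s * (norm (c \<alpha>) * s ^ deg \<alpha>))"
      by (subst sum_vimage_up[OF A, of i]) (auto simp: deg_up mult_ac)
    also have "\<dots> \<le> s * M"
      unfolding sum_distrib_left[symmetric] using radius_pos
      by (intro mult_left_mono coeff_bound finite_vimageI A inj_up) auto
    finally show "(\<Sum>\<alpha>\<in>A. norm (?c \<alpha>) * s ^ deg \<alpha>) \<le> s * M" .
  next
    fix x assume "x - p \<in> cube s"
    from has_sum_scaleR[OF expansion[OF this], of "x $ i - p $ i"]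
    show "((\<lambda>\<alpha>. mpow \<alpha> (x - p) *\<^sub>R ?c \<alpha>) has_sum (x $ i - p $ i) *\<^sub>R h x) UNIV"
      by (subst has_sum_up[of i]) (simp_all add: mpow_up)
  qed (rule radius_pos)
  then show ?thesis by (auto simp: analytic_bound_def)
qed

lemma analytic_bound_coordinate:
  assumes "analytic_bound p s M h"
  shows "analytic_bound p s ((\<bar>p $ i\<bar> + s) * M) (\<lambda>x. x $ i *\<^sub>R h x)"
proof -
  have "analytic_bound p s (\<bar>p $ i\<bar> * M + s * M) (\<lambda>x. p $ i *\<^sub>R h x + (x $ i - p $ i) *\<^sub>R h x)"
    by (intro analytic_bound_add analytic_bound_shifted_coordinate assms
        analytic_bound_bounded_linear[OF assms bounded_linear_scaleR_right]) auto
  then show ?thesis by (simp add: distrib_right flip: scaleR_add_left)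
qed

text \<open>The factor \<open>Suc (\<alpha> j)\<close> of the differentiated coefficient is at most
  the degree, and \<open>derivative_weight_le\<close> pays for the degree by shrinking the radius
  from \<open>s\<close> to \<open>t\<close>.\<close>

lemma analytic_bound_partial:
  fixes h :: "(real, 'n::finite) vec \<Rightarrow> 'n clifford"
  assumes "analytic_bound p s M h" "0 < t" "t < s"
  shows "analytic_bound p t (M / (s - t)) (partial h j)"
proof -
  obtain c where c: "multi_power_series p s M c h" using assms by (auto simp: analytic_bound_def)
  interpret multi_power_series p s M c h by (rule c)
  have "multi_power_series p t (M / (s - t)) (\<lambda>\<alpha>. real (Suc (\<alpha> j)) *\<^sub>R c (up j \<alpha>)) (partial h j)"
  proof
    fix A :: "('n \<Rightarrow> nat) set" assume A: "finite A"
    have "(\<Sum>\<alpha>\<in>A. norm (real (Suc (\<alpha> j)) *\<^sub>R c (up j \<alpha>)) * t ^ deg \<alpha>)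
        \<le> (\<Sum>\<alpha>\<in>A. (1 / (s - t)) * (norm (c (up j \<alpha>)) * s ^ deg (up j \<alpha>)))"
    proof (rule sum_mono)
      fix \<alpha>
      have "Suc (\<alpha> j) \<le> deg (up j \<alpha>)"
        unfolding deg_def using member_le_sum[of j UNIV "up j \<alpha>"] by simp
      then have "real (Suc (\<alpha> j)) * t ^ deg \<alpha> \<le> real (deg (up j \<alpha>)) * t ^ (deg (up j \<alpha>) - 1)"
        using assms by (simp add: deg_up mult_right_mono)
      also have "\<dots> \<le> s ^ deg (up j \<alpha>) / (s - t)"
        by (rule derivative_weight_le) (use assms in auto)
      finally have "norm (c (up j \<alpha>)) * (real (Suc (\<alpha> j)) * t ^ deg \<alpha>)
          \<le> norm (c (up j \<alpha>)) * (s ^ deg (up j \<alpha>) / (s - t))"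
        by (rule mult_left_mono) simp
      then show "norm (real (Suc (\<alpha> j)) *\<^sub>R c (up j \<alpha>)) * t ^ deg \<alpha>
          \<le> (1 / (s - t)) * (norm (c (up j \<alpha>)) * s ^ deg (up j \<alpha>))"
        by (simp add: mult_ac del: of_nat_Suc)
    qed
    also have "\<dots> = (1 / (s - t)) * (\<Sum>\<alpha>\<in>up j ` A. norm (c \<alpha>) * s ^ deg \<alpha>)"
      by (subst sum.reindex) (auto simp: sum_distrib_left intro: inj_on_subset[OF inj_up])
    also have "\<dots> \<le> (1 / (s - t)) * M"
      by (intro mult_left_mono coeff_bound) (use A assms in auto)
    finally show "(\<Sum>\<alpha>\<in>A. norm (real (Suc (\<alpha> j)) *\<^sub>R c (up j \<alpha>)) * t ^ deg \<alpha>) \<le> M / (s - t)" by simp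
  next
    fix x assume x: "x - p \<in> cube t"
    then have "\<bar>x $ i - p $ i\<bar> < s" for i using assms by (auto simp: mem_cube intro: le_less_trans)
    from termwise_derivative[OF this] obtain D where
      D: "\<And>i. ((\<lambda>\<alpha>. (real (\<alpha> i) * mpow (down i \<alpha>) (x - p)) *\<^sub>R c \<alpha>) has_sum D i) UNIV"
        "(h has_derivative (\<lambda>v. \<Sum>i\<in>UNIV. v $ i *\<^sub>R D i)) (at x)" by blast
    have "partial h j x = D j"
      using partial_eq[OF D(2), of j] by (simp add: sum_axis_scaleR)
    with D(1)[of j] show "((\<lambda>\<alpha>. mpow \<alpha> (x - p) *\<^sub>R real (Suc (\<alpha> j)) *\<^sub>R c (up j \<alpha>)) has_sum partial h j x) UNIV"
      by (subst (asm) has_sum_up[of j]) (simp_all add: mult.commute)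
  qed (use assms in auto)
  then show ?thesis by (auto simp: analytic_bound_def)
qed

section \<open>Local existence\<close>

text \<open>The operator x D: the Dirac operator followed by left multiplication by the position
  vector.\<close>

definition radial_Dirac ::
    "((real, 'n::{finite,linorder}) vec \<Rightarrow> 'n clifford) \<Rightarrow> (real, 'n) vec \<Rightarrow> 'n clifford" where
  "radial_Dirac h x =
     (\<Sum>i\<in>UNIV. x $ i *\<^sub>R clmul (cl_gen i) (\<Sum>j\<in>UNIV. clmul (cl_gen j) (partial h j x)))"

lemma analytic_bound_nonneg: "analytic_bound p s M h \<Longrightarrow> M \<ge> 0"
  using analytic_bound_norm_le[of p s M h p] multi_power_series.coeff_bound[of p s M _ h "{}"]
  by (auto simp: analytic_bound_def)

lemma analytic_bound_clmul_gen:
  fixes h :: "(real, 'n::{finite,linorder}) vec \<Rightarrow> 'n clifford"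
  assumes "analytic_bound p s M h"
  shows "analytic_bound p s M (\<lambda>x. clmul (cl_gen i) (h x))"
  using analytic_bound_bounded_linear[OF assms bounded_linear_clmul_gen[of i], of 1]
  by (simp add: norm_clmul_gen)

text \<open>Each of the two sums over the generators contributes n; the 2 bounds |p_i| + t.\<close>

lemma analytic_bound_radial_Dirac:
  fixes h :: "(real, 'n::{finite,linorder}) vec \<Rightarrow> 'n clifford"
  assumes h: "analytic_bound p s M h" and t: "0 < t" "t < s" "s \<le> 1" and p: "norm p = 1"
  shows "analytic_bound p t (2 * (real CARD('n))\<^sup>2 / (s - t) * M) (radial_Dirac h)"
proof -
  let ?n = "real CARD('n)"
  have 1: "analytic_bound p t (?n * (M / (s - t))) (\<lambda>x. \<Sum>j\<in>UNIV. clmul (cl_gen j) (partial h j x))"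
    by (intro analytic_bound_sum analytic_bound_clmul_gen analytic_bound_partial h t) simp
  have "analytic_bound p t (2 * (?n * (M / (s - t))))
      (\<lambda>x. x $ i *\<^sub>R clmul (cl_gen i) (\<Sum>j\<in>UNIV. clmul (cl_gen j) (partial h j x)))" for i
  proof (rule analytic_bound_antimono[OF analytic_bound_coordinate[OF analytic_bound_clmul_gen[OF 1]] t(1) order_refl])
    have "\<bar>p $ i\<bar> + t \<le> 2" using component_le_norm_cart[of p i] p t by simp
    then show "(\<bar>p $ i\<bar> + t) * (?n * (M / (s - t))) \<le> 2 * (?n * (M / (s - t)))"
      using analytic_bound_nonneg[OF 1] by (rule mult_right_mono)
  qed
  then have "analytic_bound p t (?n * (2 * (?n * (M / (s - t))))) (radial_Dirac h)"
    unfolding radial_Dirac_def[abs_def] by (intro analytic_bound_sum t) auto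
  then show ?thesis by (simp add: power2_eq_square mult_ac)
qed

lemma analytic_bound_radial_Dirac_iterate:
  fixes g :: "(real, 'n::{finite,linorder}) vec \<Rightarrow> 'n clifford"
  assumes g: "analytic_bound p s M g" and s: "0 < s" "s \<le> 1" and p: "norm p = 1"
  shows "analytic_bound p (s / 2) ((4 * (real CARD('n))\<^sup>2 * exp 1 / s) ^ k * fact k * M) ((radial_Dirac ^^ k) g)"
proof (cases "k = 0")
  case True
  then show ?thesis using analytic_bound_antimono[OF g, of "s / 2" M] s by simp
next
  case False
  let ?K = "2 * (real CARD('n))\<^sup>2"
  \<comment> \<open>Equal steps that together use half the radius. With this choice
    (\<open>?K\<close> / \<open>\<delta>\<close>)^k equals (4 n^2 / s)^k k^k; the case k = 0 was
    split off because of the denominator.\<close>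
  define \<delta> where "\<delta> = s / (2 * real k)"
  have \<delta>: "\<delta> > 0" using s False by (simp add: \<delta>_def)
  have k\<delta>: "real k * \<delta> = s / 2" using False by (simp add: \<delta>_def)
  have "analytic_bound p (s - real i * \<delta>) ((?K / \<delta>) ^ i * M) ((radial_Dirac ^^ i) g)" if "i \<le> k" for i
    using that
  proof (induction i)
    case 0
    then show ?case using g by simp
  next
    case (Suc i)
    have "real (Suc i) * \<delta> \<le> real k * \<delta>" using Suc.prems \<delta> by (intro mult_right_mono) auto
    then have pos: "0 < s - real (Suc i) * \<delta>" using k\<delta> s by linarith
    have le: "s - real i * \<delta> \<le> 1" using s \<delta> by (smt (verit) mult_nonneg_nonneg of_nat_0_le_iff)
    have diff: "(s - real i * \<delta>) - (s - real (Suc i) * \<delta>) = \<delta>" by (simp add: algebra_simps)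
    then have lt: "s - real (Suc i) * \<delta> < s - real i * \<delta>" using \<delta> by linarith
    have "analytic_bound p (s - real (Suc i) * \<delta>) (?K / \<delta> * ((?K / \<delta>) ^ i * M)) (radial_Dirac ((radial_Dirac ^^ i) g))"
      using analytic_bound_radial_Dirac[OF Suc.IH pos lt le p] Suc.prems unfolding diff by simp
    then show ?case by (simp add: mult.assoc)
  qed
  from this[of k] have "analytic_bound p (s / 2) ((?K / \<delta>) ^ k * M) ((radial_Dirac ^^ k) g)"
    by (simp add: k\<delta>)
  moreover have "(?K / \<delta>) ^ k * M \<le> (4 * (real CARD('n))\<^sup>2 * exp 1 / s) ^ k * fact k * M"
  proof (rule mult_right_mono)
    have "(?K / \<delta>) ^ k = (4 * (real CARD('n))\<^sup>2 / s * real k) ^ k"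
      unfolding \<delta>_def by (simp add: mult_ac)
    also have "\<dots> = (4 * (real CARD('n))\<^sup>2 / s) ^ k * real k ^ k" by (rule power_mult_distrib)
    also have "\<dots> \<le> (4 * (real CARD('n))\<^sup>2 / s) ^ k * (exp 1 ^ k * fact k)"
      using s by (intro mult_left_mono power_self_le_exp_fact) auto
    also have "\<dots> = (4 * (real CARD('n))\<^sup>2 / s * exp 1) ^ k * fact k"
      by (simp only: power_mult_distrib mult.assoc)
    finally show "(?K / \<delta>) ^ k \<le> (4 * (real CARD('n))\<^sup>2 * exp 1 / s) ^ k * fact k" by simp
  qed (rule analytic_bound_nonneg[OF g])
  ultimately show ?thesis using s by (auto intro: analytic_bound_antimono)
qed

text \<open>x (x D h) = - |x|^2 D h, by \<open>clmul_gen_symmetric_sum\<close> with T i j = x_i x_j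
  D h. This is the cancellation that drives the telescoping.\<close>

lemma radial_Dirac_normal:
  fixes h :: "(real, 'n::{finite,linorder}) vec \<Rightarrow> 'n clifford"
  shows "(\<Sum>i\<in>UNIV. x $ i *\<^sub>R clmul (cl_gen i) (radial_Dirac h x))
     = - (norm x)\<^sup>2 *\<^sub>R (\<Sum>j\<in>UNIV. clmul (cl_gen j) (partial h j x))" (is "_ = _ *\<^sub>R ?d")
proof -
  define d where "d = ?d"
  have "(\<Sum>i\<in>UNIV. x $ i *\<^sub>R clmul (cl_gen i) (radial_Dirac h x))
      = (\<Sum>i\<in>UNIV. \<Sum>j\<in>UNIV. clmul (cl_gen i) (clmul (cl_gen j) ((x $ i * x $ j) *\<^sub>R d)))"
    by (simp add: radial_Dirac_def d_def[symmetric] clmul_gen_sum clmul_gen_scaleR scaleR_sum_right)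
  also have "\<dots> = - (\<Sum>i\<in>UNIV. (x $ i * x $ i) *\<^sub>R d)"
    by (rule clmul_gen_symmetric_sum) (simp add: mult.commute)
  also have "\<dots> = - (norm x)\<^sup>2 *\<^sub>R d"
    by (simp add: inner_vec_def dot_square_norm[symmetric] flip: scaleR_sum_left)
  finally show ?thesis by (simp only: d_def)
qed

text \<open>Chain rule with gradient x / |x|^2 for ln |x|. Keeping k / k! in place of 1 / (k-1)!
  lets one formula cover k = 0, where the factor \<open>real k\<close> vanishes.\<close>

lemma ln_norm_power_has_derivative:
  fixes x :: "'a::real_inner"
  assumes "x \<noteq> 0"
  shows "((\<lambda>x. ln (norm x) ^ k / fact k) has_derivative
    (\<lambda>v. (real k * ln (norm x) ^ (k - 1) / fact k) * (x \<bullet> v / (norm x)\<^sup>2))) (at x)"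
proof -
  have "((\<lambda>x. ln (norm x)) has_derivative (\<lambda>v. (v \<bullet> sgn x) * inverse (norm x))) (at x)"
    using assms by (intro has_derivative_ln has_derivative_norm) auto
  moreover have "(v \<bullet> sgn x) * inverse (norm x) = x \<bullet> v / (norm x)\<^sup>2" for v
    by (simp add: sgn_div_norm inner_commute power2_eq_square divide_inverse mult_ac)
  ultimately have "((\<lambda>x. ln (norm x)) has_derivative (\<lambda>v. x \<bullet> v / (norm x)\<^sup>2)) (at x)"
    by simp
  from has_derivative_divide'[OF has_derivative_power[OF this, of k] has_derivative_const, of "fact k"]
  have "((\<lambda>x. ln (norm x) ^ k / fact k) has_derivative
    (\<lambda>v. (real k * (x \<bullet> v / (norm x)\<^sup>2) * ln (norm x) ^ (k - 1) * fact k - ln (norm x) ^ k * 0)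
      / (fact k * fact k))) (at x)" by simp
  moreover have "(r * y * l * b - z * 0) / (b * b) = r * l / b * y" if "b \<noteq> 0" for r y l z b :: real
    using that by (simp add: field_simps)
  ultimately show ?thesis by (simp only: fact_nonzero not_False_eq_True)
qed

text \<open>Absorbs the factor k from differentiating the logarithmic power by weakening the
  geometric ratio from 1 / 4 to 1 / 2.\<close>

lemma of_nat_mult_quarter_power_le: "real k * (1 / 4) ^ (k - 1) \<le> 4 * (1 / 2) ^ k"
proof (cases k)
  case (Suc m)
  have "real (Suc m) \<le> 2 ^ Suc m" using of_nat_less_two_power[of "Suc m", where 'a = real] by linarith
  then have "real (Suc m) * (1 / 4) ^ m \<le> 2 ^ Suc m * (1 / 4) ^ m" by (intro mult_right_mono) auto
  also have "\<dots> = 2 * (2 * (1 / 4)) ^ m" by (simp only: power_mult_distrib power_Suc mult.assoc)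
  also have "\<dots> = 4 * (1 / 2) ^ Suc m" by simp
  finally show ?thesis by (simp add: Suc)
qed simp

text \<open>Since \<open>D (ln |x|) = x / |x|\<^sup>2\<close> and \<open>x x = - |x|\<^sup>2\<close>, the Dirac operator maps
  \<open>(ln |x|)\<^sup>k / k! (x D)\<^sup>k g\<close> to \<open>b (k + 1) - b k\<close> with
  \<open>b (k + 1) = (ln |x|)\<^sup>k / k! D (x D)\<^sup>k g\<close> and \<open>b 0 = 0\<close>: the series telescopes.\<close>
lemma Cauchy_Kovalevskaya_sphere:
  fixes g :: "(real, 'n::{finite,linorder}) vec \<Rightarrow> 'n clifford"
  assumes g: "analytic_bound p s M g" and s: "0 < s" "s \<le> 1" and p: "norm p = 1"
  shows "\<exists>\<sigma>>0. \<exists>F. left_clifford_holomorphic_on F (ball p \<sigma>) \<and>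
    (\<forall>x\<in>sphere 0 1 \<inter> ball p \<sigma>. F x = g x)"
proof -
  let ?n = "real CARD('n)"
  define A where "A = 4 * ?n\<^sup>2 * exp 1 / s"
  have A: "A > 0" using s by (simp add: A_def)
  \<comment> \<open>\<open>A\<close> is the growth rate of the iterates, so |ln |x|| <=
    \<open>\<eta>\<close> makes the series geometric with ratio 1 / 4.\<close>
  define \<eta> where "\<eta> = 1 / (4 * A)"
  have \<eta>: "\<eta> > 0" "\<eta> * A = 1 / 4" using A by (simp_all add: \<eta>_def)
  have M: "M \<ge> 0" by (rule analytic_bound_nonneg[OF g])
  have "isCont (\<lambda>x. ln (norm x)) p" using p by (intro continuous_intros) auto
  then obtain \<sigma>1 where \<sigma>1: "\<sigma>1 > 0" "\<And>x. dist x p < \<sigma>1 \<Longrightarrow> \<bar>ln (norm x)\<bar> < \<eta>"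
    using \<eta>(1) p unfolding continuous_at_eps_delta by (auto simp: dist_norm)
  \<comment> \<open>\<open>\<sigma>1\<close> keeps ln |x| below \<open>\<eta>\<close>, 1 / 2 keeps
    |x| away from 0, and s / 4 stays inside the cube where the derivatives of the iterates are
    bounded (their own bounds hold up to s / 2).\<close>
  define \<sigma> where "\<sigma> = Min {\<sigma>1, 1 / 2, s / 4}"
  have \<sigma>: "\<sigma> > 0" "\<sigma> \<le> \<sigma>1" "\<sigma> \<le> 1 / 2" "\<sigma> \<le> s / 4" using \<sigma>1 s by (auto simp: \<sigma>_def)
  define V where "V = ball p \<sigma>"
  have V: "open V" "convex V" by (simp_all add: V_def)
  have lV: "\<bar>ln (norm x)\<bar> \<le> \<eta>" if "x \<in> V" for x
    using \<sigma>1(2)[of x] that \<sigma> by (simp add: V_def dist_commute)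
  have nV: "norm x \<ge> 1 / 2" if "x \<in> V" for x
    using that \<sigma> p norm_triangle_ineq2[of p "p - x"] by (simp add: V_def dist_norm)
  then have xV: "x \<noteq> 0" if "x \<in> V" for x using that by fastforce
  have cV: "\<bar>x $ i - p $ i\<bar> < s / 4" if "x \<in> V" for x i
    using component_le_norm_cart[of "x - p" i] that \<sigma> by (simp add: V_def dist_norm norm_minus_commute)
  define h where "h k = (radial_Dirac ^^ k) g" for k
  define N where "N k = A ^ k * fact k * M" for k
  have N0: "N k \<ge> 0" for k using A M by (simp add: N_def)
  have h: "analytic_bound p (s / 2) (N k) (h k)" for k
    unfolding h_def N_def A_def by (rule analytic_bound_radial_Dirac_iterate[OF g s p])
  have hp: "analytic_bound p (s / 4) (N k * (4 / s)) (partial (h k) j)" for k j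
    using analytic_bound_partial[OF h, of "s / 4" k j] s by (simp add: field_simps)
  have hb: "norm (h k x) \<le> N k" if "x \<in> V" for k x
  proof (rule analytic_bound_norm_le[OF h])
    have "\<bar>x $ i - p $ i\<bar> \<le> s / 2" for i using cV[OF that, of i] s by linarith
    then show "x - p \<in> cube (s / 2)" by (simp add: mem_cube)
  qed
  have pb: "norm (partial (h k) j x) \<le> N k * (4 / s)" if "x \<in> V" for k j x
    by (rule analytic_bound_norm_le[OF hp]) (use cV[OF that] in \<open>auto simp: mem_cube intro: less_imp_le\<close>)
  have hd: "h k differentiable (at x)" if "x \<in> V" for k x
    by (rule analytic_bound_differentiable[OF h]) (rule less_trans[OF cV[OF that]], use s in simp)
  have pc: "continuous_on V (partial (h k) j)" for k j
    using analytic_bound_differentiable[OF hp cV]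
    by (intro continuous_at_imp_continuous_on ballI differentiable_imp_continuous_within)
  have hc: "continuous_on V (h k)" for k
    using hd by (intro continuous_at_imp_continuous_on ballI differentiable_imp_continuous_within)

  define a where "a k x = ln (norm x) ^ k / fact k" for k and x :: "(real, 'n) vec"
  define q where "q k x = real k * ln (norm x) ^ (k - 1) / fact k" for k and x :: "(real, 'n) vec"
  have aN: "\<bar>a k x\<bar> * N k \<le> (1 / 4) ^ k * M" if "x \<in> V" for k x
  proof -
    have "\<bar>a k x\<bar> * N k = \<bar>ln (norm x)\<bar> ^ k * A ^ k * M" by (simp add: a_def N_def power_abs)
    also have "\<dots> \<le> \<eta> ^ k * A ^ k * M"
      using lV[OF that] A M by (intro mult_right_mono power_mono) auto
    also have "\<dots> = (1 / 4) ^ k * M" by (simp only: power_mult_distrib[symmetric] \<eta>)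
    finally show ?thesis .
  qed
  have qN: "\<bar>q k x\<bar> * N k \<le> 4 * A * M * (1 / 2) ^ k" if "x \<in> V" for k x
  proof (cases k)
    case 0
    then show ?thesis using A M by (simp add: q_def)
  next
    case (Suc m)
    have "\<bar>q k x\<bar> * N k = real k * (\<bar>ln (norm x)\<bar> ^ (k - 1) * A ^ k) * M"
      by (simp add: q_def N_def power_abs abs_mult)
    also have "\<dots> \<le> real k * (\<eta> ^ (k - 1) * A ^ k) * M"
      using lV[OF that] A M by (intro mult_right_mono mult_left_mono power_mono) auto
    also have "\<dots> = (real k * (\<eta> * A) ^ (k - 1)) * (A * M)"
      by (simp add: Suc power_mult_distrib)
    also have "\<dots> \<le> (4 * (1 / 2) ^ k) * (A * M)"
      unfolding \<eta> using A M by (intro mult_right_mono of_nat_mult_quarter_power_le) auto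
    finally show ?thesis by (simp add: mult_ac)
  qed
  define F where "F x = (\<Sum>k. a k x *\<^sub>R h k x)" for x
  define f' where "f' k x v = a k x *\<^sub>R (\<Sum>j\<in>UNIV. v $ j *\<^sub>R partial (h k) j x)
      + (q k x * (x \<bullet> v / (norm x)\<^sup>2)) *\<^sub>R h k x" for k x v
  \<comment> \<open>The first summand bounds the part that differentiates \<open>h k\<close>, the
    second the part that differentiates the logarithm: 8 is the 4 of \<open>qN\<close> times the 2
    from 1 / |x| <= 2.\<close>
  define B where "B k = (?n * (4 / s) * M + 8 * A * M) * (1 / 2) ^ k" for k :: nat
  have B: "summable B" unfolding B_def by (intro summable_mult summable_geometric) simp
  have fb: "norm (f' k x v) \<le> B k * norm v" if x: "x \<in> V" for k x v
  proof -
    have "norm (\<Sum>j\<in>UNIV. v $ j *\<^sub>R partial (h k) j x) \<le> (\<Sum>j\<in>(UNIV::'n set). norm v * (N k * (4 / s)))"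
      by (rule sum_norm_le, subst norm_scaleR, rule mult_mono)
        (simp_all only: real_norm_def component_le_norm_cart pb[OF x] norm_ge_zero)
    then have "norm (a k x *\<^sub>R (\<Sum>j\<in>UNIV. v $ j *\<^sub>R partial (h k) j x))
        \<le> \<bar>a k x\<bar> * (?n * (norm v * (N k * (4 / s))))"
      unfolding norm_scaleR by (intro mult_left_mono) simp_all
    also have "\<dots> = (\<bar>a k x\<bar> * N k) * (?n * (4 / s) * norm v)" by (simp add: mult_ac)
    also have "\<dots> \<le> ((1 / 4) ^ k * M) * (?n * (4 / s) * norm v)"
      using s by (intro mult_right_mono aN x) auto
    also have "\<dots> \<le> ((1 / 2) ^ k * M) * (?n * (4 / s) * norm v)"
      using s M by (intro mult_right_mono power_mono) auto
    finally have 1: "norm (a k x *\<^sub>R (\<Sum>j\<in>UNIV. v $ j *\<^sub>R partial (h k) j x))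
        \<le> (?n * (4 / s) * M) * (1 / 2) ^ k * norm v" by (simp add: mult_ac)
    have "\<bar>x \<bullet> v / (norm x)\<^sup>2\<bar> \<le> norm x * norm v / (norm x)\<^sup>2"
      using Cauchy_Schwarz_ineq2[of x v] by (simp add: divide_right_mono)
    also have "\<dots> = norm v / norm x" using xV[OF x] by (simp add: power2_eq_square)
    also have "\<dots> \<le> norm v / (1 / 2)" using nV[OF x] by (intro divide_left_mono) auto
    finally have xv: "\<bar>x \<bullet> v / (norm x)\<^sup>2\<bar> \<le> 2 * norm v" by simp
    have "norm ((q k x * (x \<bullet> v / (norm x)\<^sup>2)) *\<^sub>R h k x) = \<bar>q k x\<bar> * \<bar>x \<bullet> v / (norm x)\<^sup>2\<bar> * norm (h k x)"
      by (simp only: norm_scaleR abs_mult)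
    also have "\<dots> \<le> \<bar>q k x\<bar> * (2 * norm v) * N k"
      by (intro mult_mono mult_left_mono xv hb x) auto
    also have "\<dots> = (\<bar>q k x\<bar> * N k) * (2 * norm v)" by simp
    also have "\<dots> \<le> (4 * A * M * (1 / 2) ^ k) * (2 * norm v)" by (intro mult_right_mono qN x) auto
    finally have 2: "norm ((q k x * (x \<bullet> v / (norm x)\<^sup>2)) *\<^sub>R h k x) \<le> (8 * A * M) * (1 / 2) ^ k * norm v"
      by (simp add: mult_ac)
    have "norm (f' k x v) \<le> (?n * (4 / s) * M) * (1 / 2) ^ k * norm v + (8 * A * M) * (1 / 2) ^ k * norm v"
      unfolding f'_def using norm_triangle_mono[OF 1 2] .
    then show ?thesis by (simp only: B_def distrib_right)
  qed
  have dF: "(F has_derivative (\<lambda>v. \<Sum>k. f' k x v)) (at x)" if x: "x \<in> V" for x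
    unfolding F_def[abs_def]
  proof (rule has_derivative_suminf[OF V _ fb B _ x])
    fix k y assume y: "y \<in> V"
    from has_derivative_scaleR[OF ln_norm_power_has_derivative[OF xV[OF y], of k]
        differentiable_imp_has_derivative_partial[OF hd[OF y, of k]]]
    show "((\<lambda>x. a k x *\<^sub>R h k x) has_derivative f' k y) (at y)"
      unfolding f'_def a_def q_def by simp
  next
    fix y assume y: "y \<in> V"
    show "summable (\<lambda>k. a k y *\<^sub>R h k y)"
    proof (rule summable_comparison_test'[where N = 0])
      show "summable (\<lambda>k. (1 / 4) ^ k * M)" by (intro summable_mult2 summable_geometric) simp
      show "norm (a k y *\<^sub>R h k y) \<le> (1 / 4) ^ k * M" for k
        using mult_left_mono[OF hb[OF y, of k] abs_ge_zero[of "a k y"]] aN[OF y, of k] by simp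
    qed
  qed
  have pF: "partial F j x = (\<Sum>k. f' k x (axis j 1))" if "x \<in> V" for x j
    by (rule partial_eq[OF dF[OF that]])
  have f'_axis: "f' k x (axis j 1) = a k x *\<^sub>R partial (h k) j x + (q k x * (x $ j / (norm x)\<^sup>2)) *\<^sub>R h k x" for k x j
    by (simp add: f'_def sum_axis_scaleR inner_axis)
  have cont: "continuous_on V (partial F j)" for j
  proof -
    have "continuous_on V (\<lambda>x. f' k x (axis j 1))" for k
      unfolding f'_axis a_def q_def using xV
      by (intro continuous_intros pc hc) auto
    then have "\<forall>\<^sub>F n in sequentially. continuous_on V (\<lambda>x. \<Sum>k<n. f' k x (axis j 1))"
      by (intro always_eventually allI continuous_on_sum)
    moreover have "uniform_limit V (\<lambda>n x. \<Sum>k<n. f' k x (axis j 1)) (\<lambda>x. \<Sum>k. f' k x (axis j 1)) sequentially"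
      by (rule Weierstrass_m_test[OF _ B]) (use fb[where v = "axis j 1"] in simp)
    ultimately have "continuous_on V (\<lambda>x. \<Sum>k. f' k x (axis j 1))"
      by (rule uniform_limit_theorem) simp
    then show ?thesis by (rule continuous_on_eq) (simp add: pF)
  qed
  have Dirac: "(\<Sum>j\<in>UNIV. clmul (cl_gen j) (partial F j x)) = 0" if x: "x \<in> V" for x
  proof -
    define d where "d k = (\<Sum>j\<in>UNIV. clmul (cl_gen j) (partial (h k) j x))" for k
    \<comment> \<open>The index is shifted by one: \<open>b (Suc k)\<close> comes from
      differentiating the k-th iterate, and \<open>b k\<close> cancels the logarithmic derivative of
      the k-th term. The value 0 at k = 0 matches \<open>q 0 x = 0\<close>.\<close>
    define b where "b k = (case k of 0 \<Rightarrow> 0 | Suc m \<Rightarrow> a m x *\<^sub>R d m)" for k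
    have "summable (\<lambda>k. f' k x (axis j 1))" for j
      by (rule summable_comparison_test'[OF B, of 0]) (use fb[OF x, where v = "axis j 1"] in simp)
    then have "(\<lambda>k. f' k x (axis j 1)) sums partial F j x" for j
      unfolding pF[OF x] by (rule summable_sums)
    then have sums: "(\<lambda>k. \<Sum>j\<in>UNIV. clmul (cl_gen j) (f' k x (axis j 1)))
        sums (\<Sum>j\<in>UNIV. clmul (cl_gen j) (partial F j x))"
      by (intro sums_sum bounded_linear.sums[OF bounded_linear_clmul_gen])
    have term_eq: "(\<Sum>j\<in>UNIV. clmul (cl_gen j) (f' k x (axis j 1))) = b (Suc k) - b k" for k
    proof -
      have "(\<Sum>j\<in>UNIV. clmul (cl_gen j) (f' k x (axis j 1)))
          = a k x *\<^sub>R d k + (q k x / (norm x)\<^sup>2) *\<^sub>R (\<Sum>j\<in>UNIV. x $ j *\<^sub>R clmul (cl_gen j) (h k x))"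
        by (simp add: f'_axis d_def clmul_gen_add clmul_gen_scaleR sum.distrib scaleR_sum_right)
      also have "\<dots> = b (Suc k) - b k"
      proof (cases k)
        case 0
        then show ?thesis by (simp add: b_def q_def)
      next
        case (Suc m)
        have "h k = radial_Dirac (h m)" by (simp add: h_def Suc)
        then have "(\<Sum>j\<in>UNIV. x $ j *\<^sub>R clmul (cl_gen j) (h k x)) = - (norm x)\<^sup>2 *\<^sub>R d m"
          by (simp only: radial_Dirac_normal d_def)
        moreover have "q k x = a m x" by (simp add: q_def a_def Suc del: of_nat_Suc)
        ultimately show ?thesis using xV[OF x] by (simp add: b_def Suc)
      qed
      finally show ?thesis .
    qed
    have "(\<lambda>k. a k x *\<^sub>R d k) \<longlonglongrightarrow> 0"
    proof (rule Lim_null_comparison)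
      show "\<forall>\<^sub>F k in sequentially. norm (a k x *\<^sub>R d k) \<le> (1 / 4) ^ k * (M * (?n * (4 / s)))"
      proof (rule always_eventually, rule allI)
        fix k
        have "norm (d k) \<le> (\<Sum>j\<in>(UNIV::'n set). N k * (4 / s))"
          unfolding d_def by (rule sum_norm_le) (simp only: norm_clmul_gen pb[OF x])
        then have "norm (a k x *\<^sub>R d k) \<le> \<bar>a k x\<bar> * (?n * (N k * (4 / s)))"
          unfolding norm_scaleR by (intro mult_left_mono) simp_all
        also have "\<dots> = (\<bar>a k x\<bar> * N k) * (?n * (4 / s))" by (simp add: mult_ac)
        also have "\<dots> \<le> ((1 / 4) ^ k * M) * (?n * (4 / s))"
          using s by (intro mult_right_mono aN x) auto
        finally show "norm (a k x *\<^sub>R d k) \<le> (1 / 4) ^ k * (M * (?n * (4 / s)))" by (simp only: mult.assoc)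
      qed
      show "(\<lambda>k. (1 / 4) ^ k * (M * (?n * (4 / s)))) \<longlonglongrightarrow> 0"
        by (intro tendsto_mult_left_zero LIMSEQ_power_zero) simp
    qed
    then have "(\<lambda>k. b (Suc k)) \<longlonglongrightarrow> 0" by (simp add: b_def)
    then have "b \<longlonglongrightarrow> 0" by (simp only: filterlim_sequentially_Suc)
    from telescope_sums[OF this] have "(\<lambda>k. \<Sum>j\<in>UNIV. clmul (cl_gen j) (f' k x (axis j 1))) sums 0"
      unfolding term_eq by (simp add: b_def)
    with sums show ?thesis by (rule sums_unique2)
  qed
  have "left_clifford_holomorphic_on F V"
    unfolding left_clifford_holomorphic_on_def differentiable_def
    using V(1) dF cont Dirac by blast
  moreover have "F x = g x" if "x \<in> sphere 0 1" for x
  proof -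
    \<comment> \<open>On the sphere ln |x| = 0, so only k = 0 survives, where 0 ^ 0 = 1.\<close>
    have "F x = (\<Sum>k\<in>{0}. a k x *\<^sub>R h k x)"
      unfolding F_def using that by (intro suminf_finite) (auto simp: a_def)
    then show ?thesis by (simp add: a_def h_def)
  qed
  ultimately show ?thesis using \<sigma>(1) unfolding V_def by blast
qed

section \<open>Gluing\<close>

lemma left_clifford_holomorphic_on_locally:
  fixes F :: "(real, 'n::{finite,linorder}) vec \<Rightarrow> 'n clifford"
  assumes "open U" and "\<And>x. x \<in> U \<Longrightarrow> \<exists>W G. x \<in> W \<and> left_clifford_holomorphic_on G W \<and> (\<forall>y\<in>W. F y = G y)"
  shows "left_clifford_holomorphic_on F U"
proof -
  have "F differentiable (at x) \<and> (\<forall>j. isCont (partial F j) x) \<and>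
      (\<Sum>j\<in>UNIV. clmul (cl_gen j) (partial F j x)) = 0" if xU: "x \<in> U" for x
  proof -
    obtain W G where x: "x \<in> W" and G: "left_clifford_holomorphic_on G W" and eq: "\<And>y. y \<in> W \<Longrightarrow> F y = G y"
      using assms(2)[OF xU] by blast
    have W: "open W" by (rule holo_open[OF G])
    have P: "partial F j y = partial G j y" if "y \<in> W" for j y
      using partial_transform_open(2)[OF W that eq holo_has_derivative[OF G that]] by (simp add: sum_axis_scaleR)
    have "continuous_on W (partial F j)" for j
      using holo_continuous_partial[OF G] by (rule continuous_on_eq) (simp add: P)
    then have "isCont (partial F j) x" for j using W x continuous_on_eq_continuous_at by blast
    moreover have "F differentiable (at x)"
      using partial_transform_open(1)[OF W x eq holo_has_derivative[OF G x]] by (auto simp: differentiable_def)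
    ultimately show ?thesis using holo_Dirac[OF G x] by (simp add: P[OF x])
  qed
  then show ?thesis
    unfolding left_clifford_holomorphic_on_def
    using assms(1) by (auto intro!: continuous_at_imp_continuous_on)
qed

lemma left_clifford_holomorphic_on_subset:
  assumes "left_clifford_holomorphic_on F U" "open V" "V \<subseteq> U"
  shows "left_clifford_holomorphic_on F V"
  using assms unfolding left_clifford_holomorphic_on_def
  by (meson continuous_on_subset subsetD)

lemma left_clifford_holomorphic_on_diff:
  fixes F G :: "(real, 'n::{finite,linorder}) vec \<Rightarrow> 'n clifford"
  assumes F: "left_clifford_holomorphic_on F U" and G: "left_clifford_holomorphic_on G U"
  shows "left_clifford_holomorphic_on (\<lambda>x. F x - G x) U"
proof -
  have d: "((\<lambda>x. F x - G x) has_derivative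
      (\<lambda>h. (\<Sum>j\<in>UNIV. h $ j *\<^sub>R partial F j x) - (\<Sum>j\<in>UNIV. h $ j *\<^sub>R partial G j x))) (at x)" if "x \<in> U" for x
    by (intro has_derivative_diff holo_has_derivative[OF F] holo_has_derivative[OF G] that)
  have P: "partial (\<lambda>x. F x - G x) j x = partial F j x - partial G j x" if "x \<in> U" for j x
    using partial_eq[OF d[OF that], of j] by (simp add: sum_axis_scaleR)
  have "continuous_on U (partial (\<lambda>x. F x - G x) j)" for j
    by (rule continuous_on_eq[OF continuous_on_diff[OF holo_continuous_partial[OF F] holo_continuous_partial[OF G]]])
      (simp add: P)
  then show ?thesis
    using holo_open[OF F] d holo_Dirac[OF F] holo_Dirac[OF G]
    unfolding left_clifford_holomorphic_on_def differentiable_def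
    by (auto simp: P clmul_gen_diff sum_subtractf)
qed

text \<open>At the corner of the cube all |x_i - p_i| equal s, so absolute convergence at that
  single point is the weighted l^1 bound.\<close>

lemma real_analytic_at_imp_analytic_bound:
  fixes g :: "real ^ 'n \<Rightarrow> 'b::banach"
  assumes "real_analytic_at g p"
  shows "\<exists>s M. 0 < s \<and> s \<le> 1 \<and> analytic_bound p s M g"
proof -
  obtain r c where r: "r > 0" and c: "\<And>x. x \<in> ball p r \<Longrightarrow>
        (\<lambda>\<alpha>. norm ((\<Prod>i\<in>UNIV. (x $ i - p $ i) ^ \<alpha> i) *\<^sub>R c \<alpha>)) summable_on UNIV"
      "\<And>x. x \<in> ball p r \<Longrightarrow> ((\<lambda>\<alpha>. (\<Prod>i\<in>UNIV. (x $ i - p $ i) ^ \<alpha> i) *\<^sub>R c \<alpha>) has_sum g x) UNIV"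
    using assms unfolding real_analytic_at_def by blast
  let ?n = "real CARD('n)"
  \<comment> \<open>Vectors in the cube have norm at most s n < r, so the whole cube lies in the
    ball of convergence.\<close>
  define s where "s = min 1 (r / (2 * ?n))"
  have s: "0 < s" "s \<le> 1" "s * ?n < r"
  proof -
    have "s \<le> r / (2 * ?n)" by (simp add: s_def)
    then have "s * ?n \<le> r / 2" by (simp add: field_simps)
    then show "s * ?n < r" using r by simp
  qed (use r in \<open>auto simp: s_def\<close>)
  have ball: "x \<in> ball p r" if "x - p \<in> cube s" for x
    using norm_le_of_mem_cube[OF that] s by (simp add: dist_norm norm_minus_commute)
  define w where "w \<alpha> = norm (c \<alpha>) * s ^ deg \<alpha>" for \<alpha>
  have "p + (\<chi> i. s) \<in> ball p r" by (rule ball) (use s in \<open>simp add: mem_cube\<close>)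
  from c(1)[OF this] have "w summable_on UNIV"
    using s by (simp add: w_def[abs_def] deg_def power_sum abs_prod mult.commute)
  then have "sum w A \<le> infsum w UNIV" if "finite A" for A
    using that s by (intro finite_sum_le_infsum) (auto simp: w_def)
  then have "multi_power_series p s (infsum w UNIV) c g"
    using c(2)[OF ball] s by unfold_locales (auto simp: w_def mpow_def)
  then show ?thesis using s unfolding analytic_bound_def by blast
qed

lemma local_existence:
  fixes f :: "(real, 'n::{finite,linorder}) vec \<Rightarrow> 'n clifford"
  assumes f: "real_analytic_on_sphere f" and p: "p \<in> sphere 0 1"
  shows "\<exists>\<sigma> F. \<sigma> > 0 \<and> left_clifford_holomorphic_on F (ball p \<sigma>) \<and>
    (\<forall>x\<in>sphere 0 1 \<inter> ball p \<sigma>. F x = f x)"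
proof -
  obtain g r where g: "real_analytic_at g p" and r: "r > 0" "\<And>x. x \<in> sphere 0 1 \<inter> ball p r \<Longrightarrow> g x = f x"
    using f p unfolding real_analytic_on_sphere_def by blast
  obtain s M where "0 < s" "s \<le> 1" "analytic_bound p s M g"
    using real_analytic_at_imp_analytic_bound[OF g] by blast
  then obtain \<sigma> F where \<sigma>: "\<sigma> > 0" and F: "left_clifford_holomorphic_on F (ball p \<sigma>)"
    "\<And>x. x \<in> sphere 0 1 \<inter> ball p \<sigma> \<Longrightarrow> F x = g x"
    using Cauchy_Kovalevskaya_sphere[of p s M g] p by auto
  have "left_clifford_holomorphic_on F (ball p (min \<sigma> r))"
    by (rule left_clifford_holomorphic_on_subset[OF F(1)]) auto
  then show ?thesis using \<sigma> r F(2)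
    by (intro exI[of _ "min \<sigma> r"] exI[of _ F]) auto
qed

text \<open>Uniqueness is that of germs along the sphere: \<open>U1 \<inter> U2\<close> may have
  components that do not meet the sphere, so agreement is claimed on some neighbourhood
  \<open>V\<close> inside it.\<close>

theorem theorem8:
  fixes f :: "(real, 'n::{finite,linorder}) vec \<Rightarrow> 'n clifford"
  assumes "real_analytic_on_sphere f"
  shows "(\<exists>U F. open U \<and> sphere 0 1 \<subseteq> U \<and> left_clifford_holomorphic_on F U \<and>
                (\<forall>x\<in>sphere 0 1. F x = f x))
       \<and> (\<forall>U1 F1 U2 F2. open U1 \<and> sphere 0 1 \<subseteq> U1 \<and> left_clifford_holomorphic_on F1 U1 \<and>
                (\<forall>x\<in>sphere 0 1. F1 x = f x) \<and>
                open U2 \<and> sphere 0 1 \<subseteq> U2 \<and> left_clifford_holomorphic_on F2 U2 \<and>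
                (\<forall>x\<in>sphere 0 1. F2 x = f x) \<longrightarrow>
           (\<exists>V. open V \<and> sphere 0 1 \<subseteq> V \<and> V \<subseteq> U1 \<inter> U2 \<and> (\<forall>x\<in>V. F1 x = F2 x)))"
proof -
  obtain c where c: "c > 0" and uniq: "\<And>(H :: (real, 'n) vec \<Rightarrow> 'n clifford) U p R x.
     left_clifford_holomorphic_on H U \<Longrightarrow> p \<in> sphere 0 1 \<Longrightarrow> R > 0 \<Longrightarrow> cball p R \<subseteq> U \<Longrightarrow>
     \<forall>x\<in>sphere 0 1 \<inter> U. H x = 0 \<Longrightarrow> x \<in> ball p (c * R) \<Longrightarrow> H x = 0"
    using holo_sphere_local_uniqueness by metis
  have "\<forall>p. \<exists>\<sigma> F. p \<in> sphere 0 1 \<longrightarrow> \<sigma> > 0 \<and> left_clifford_holomorphic_on F (ball p \<sigma>) \<and>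
      (\<forall>x\<in>sphere 0 1 \<inter> ball p \<sigma>. F x = f x)"
    using local_existence[OF assms] by blast
  then obtain \<sigma> \<Phi> where \<sigma>: "\<And>p. p \<in> sphere 0 1 \<Longrightarrow> \<sigma> p > 0"
    and \<Phi>: "\<And>p. p \<in> sphere 0 1 \<Longrightarrow> left_clifford_holomorphic_on (\<Phi> p) (ball p (\<sigma> p))"
    and \<Phi>f: "\<And>p x. p \<in> sphere 0 1 \<Longrightarrow> x \<in> sphere 0 1 \<inter> ball p (\<sigma> p) \<Longrightarrow> \<Phi> p x = f x"
    by metis
  \<comment> \<open>With 1 / 4, two meeting balls have centres closer than half the larger
    \<open>\<sigma>\<close>, so the half ball of the smaller one lies in both domains. With c / 2,
    the point \<open>x\<close> falls within the reach of \<open>uniq\<close> for that half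
    ball.\<close>
  define a where "a = min (c / 2) (1 / 4)"
  have a: "a > 0" "a \<le> c / 2" "a \<le> 1 / 4" using c by (auto simp: a_def)
  have compat_le: "\<Phi> p x = \<Phi> q x" if pq: "p \<in> sphere 0 1" "q \<in> sphere 0 1"
    and x: "x \<in> ball p (a * \<sigma> p)" "x \<in> ball q (a * \<sigma> q)" and le: "\<sigma> p \<le> \<sigma> q" for p q x
  proof -
    let ?W = "ball p (\<sigma> p) \<inter> ball q (\<sigma> q)"
    have "left_clifford_holomorphic_on (\<lambda>x. \<Phi> p x - \<Phi> q x) ?W"
      by (intro left_clifford_holomorphic_on_diff left_clifford_holomorphic_on_subset[OF \<Phi>[OF pq(1)]]
          left_clifford_holomorphic_on_subset[OF \<Phi>[OF pq(2)]]) auto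
    moreover have "cball p (\<sigma> p / 2) \<subseteq> ?W"
    proof
      fix y assume y: "y \<in> cball p (\<sigma> p / 2)"
      have "a * \<sigma> p \<le> 1 / 4 * \<sigma> q" "a * \<sigma> q \<le> 1 / 4 * \<sigma> q"
        using a le \<sigma>[OF pq(1)] \<sigma>[OF pq(2)] by (intro mult_mono; simp)+
      moreover have "dist q p \<le> dist q x + dist p x" by (rule dist_triangle2)
      ultimately have "dist q p < \<sigma> q / 2" using x by simp
      moreover have "dist q y \<le> dist q p + dist p y" by (rule dist_triangle)
      ultimately show "y \<in> ?W" using y le \<sigma>[OF pq(1)] by simp
    qed
    moreover have "x \<in> ball p (c * (\<sigma> p / 2))"
    proof -
      have "a * \<sigma> p \<le> c / 2 * \<sigma> p" by (rule mult_right_mono[OF a(2)]) (use \<sigma>[OF pq(1)] in simp)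
      then have "a * \<sigma> p \<le> c * (\<sigma> p / 2)" by simp
      then show ?thesis using x(1) unfolding mem_ball by linarith
    qed
    ultimately have "\<Phi> p x - \<Phi> q x = 0"
      using \<sigma>[OF pq(1)] \<Phi>f pq by (intro uniq[of "\<lambda>x. \<Phi> p x - \<Phi> q x" ?W p "\<sigma> p / 2" x]) auto
    then show ?thesis by simp
  qed
  have compat: "\<Phi> p x = \<Phi> q x" if "p \<in> sphere 0 1" "q \<in> sphere 0 1"
    "x \<in> ball p (a * \<sigma> p)" "x \<in> ball q (a * \<sigma> q)" for p q x
    using compat_le[of p q x] compat_le[of q p x] that by (cases "\<sigma> p \<le> \<sigma> q") auto
  define U where "U = (\<Union>p\<in>sphere 0 1. ball p (a * \<sigma> p))"
  \<comment> \<open>The choice of the centre is immaterial by \<open>compat\<close>.\<close>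
  define F where "F x = \<Phi> (SOME p. p \<in> sphere 0 1 \<and> x \<in> ball p (a * \<sigma> p)) x" for x
  have F: "F x = \<Phi> p x" if "p \<in> sphere 0 1" "x \<in> ball p (a * \<sigma> p)" for p x
  proof -
    have "\<exists>p. p \<in> sphere 0 1 \<and> x \<in> ball p (a * \<sigma> p)" using that by blast
    from someI_ex[OF this] show ?thesis unfolding F_def using compat that by blast
  qed
  have sub: "ball p (a * \<sigma> p) \<subseteq> ball p (\<sigma> p)" if "p \<in> sphere 0 1" for p
    using a \<sigma>[OF that] by (intro subset_ball) simp
  have "open U" by (auto simp: U_def)
  moreover have "sphere 0 1 \<subseteq> U" using a \<sigma> by (force simp: U_def)
  moreover have "left_clifford_holomorphic_on F U"
  proof (rule left_clifford_holomorphic_on_locally[OF \<open>open U\<close>])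
    fix x assume "x \<in> U"
    then obtain p where p: "p \<in> sphere 0 1" "x \<in> ball p (a * \<sigma> p)" by (auto simp: U_def)
    then show "\<exists>W G. x \<in> W \<and> left_clifford_holomorphic_on G W \<and> (\<forall>y\<in>W. F y = G y)"
      using F left_clifford_holomorphic_on_subset[OF \<Phi>[OF p(1)] open_ball sub[OF p(1)]] by blast
  qed
  moreover have "F x = f x" if "x \<in> sphere 0 1" for x
    using F[OF that, of x] \<Phi>f[OF that, of x] a \<sigma>[OF that] that by simp
  ultimately have existence: "\<exists>U F. open U \<and> sphere 0 1 \<subseteq> U \<and> left_clifford_holomorphic_on F U \<and>
      (\<forall>x\<in>sphere 0 1. F x = f x)" by blast
  have uniqueness: "\<exists>V. open V \<and> sphere 0 1 \<subseteq> V \<and> V \<subseteq> U1 \<inter> U2 \<and> (\<forall>x\<in>V. F1 x = F2 x)"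
    if U: "open U1" "sphere 0 1 \<subseteq> U1" "open U2" "sphere 0 1 \<subseteq> U2"
      and F: "left_clifford_holomorphic_on F1 U1" "left_clifford_holomorphic_on F2 U2"
      and eq: "\<And>x. x \<in> sphere 0 1 \<Longrightarrow> F1 x = f x" "\<And>x. x \<in> sphere 0 1 \<Longrightarrow> F2 x = f x"
    for U1 F1 U2 F2
  proof -
    let ?W = "U1 \<inter> U2"
    have W: "open ?W" using U by auto
    have H: "left_clifford_holomorphic_on (\<lambda>x. F1 x - F2 x) ?W"
      by (intro left_clifford_holomorphic_on_diff left_clifford_holomorphic_on_subset[OF F(1) W]
          left_clifford_holomorphic_on_subset[OF F(2) W]) auto
    have local: "\<exists>\<epsilon>>0. \<forall>x\<in>ball p \<epsilon>. F1 x = F2 x" if p: "p \<in> sphere 0 1" for p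
    proof -
      have "p \<in> ?W" using p U by blast
      then obtain R where R: "R > 0" "cball p R \<subseteq> ?W" using W by (meson open_contains_cball)
      have "F1 x - F2 x = 0" if "x \<in> ball p (c * R)" for x
        by (rule uniq[OF H p R _ that]) (use eq in auto)
      then show ?thesis using c R by (intro exI[of _ "c * R"]) auto
    qed
    then obtain \<epsilon> where \<epsilon>: "\<And>p. p \<in> sphere 0 1 \<Longrightarrow> \<epsilon> p > 0"
      "\<And>p x. p \<in> sphere 0 1 \<Longrightarrow> x \<in> ball p (\<epsilon> p) \<Longrightarrow> F1 x = F2 x" by metis
    show ?thesis
    proof (intro exI[of _ "(\<Union>p\<in>sphere 0 1. ball p (\<epsilon> p)) \<inter> ?W"] conjI)
      show "sphere 0 1 \<subseteq> (\<Union>p\<in>sphere 0 1. ball p (\<epsilon> p)) \<inter> ?W" using \<epsilon>(1) U by force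
    qed (use W \<epsilon>(2) in auto)
  qed
  show ?thesis
    by (intro conjI allI impI existence, elim conjE) (rule uniqueness, auto)
qed

end
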